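(* Let $n,p$ be real numbers with $0<p<n/2$ and let $W=W_{p,n}$. The algebra $\mathcal D(W)$ is generated by $\{D_1+D_2,\;D_3+D_4\}$, where $D_1,D_2,D_3,D_4\in\mathcal D(W)$ are the second order operators listed in the context.
   Context: Weight: for real $0<p<n/2$, $$W_{p,n}(x)=(1-x^2)^{\frac n2-1}\begin{pmatrix} p\,x^2+n-p & -nx\\ -nx & (n-p)x^2+p\end{pmatrix},\quad x\in[-1,1].$$ $M_2$ denotes complex $2\times2$ matrices, $T^*$ the conjugate transpose. On $M_2[x]$ use the matrix-valued form $(P,Q)=\int_{-1}^1 P(x)W(x)Q(x)^*\,dx$; $\{Q_w\}_{w\ge0}$ is the unique sequence of monic orthogonal polynomials ($Q_w\in M_2[x]$ monic of degree $w$, $(Q_w,Q_{w'})=0$ for $w\neq w'$). Differential operators $D=\sum_{i=0}^s\partial^iF_i$, $\partial=\frac{d}{dx}$, $F_i\in M_2[x]$, act on the right: $PD=\sum_i \partial^i(P)\,F_i$; the product satisfies $P(DE)=(PD)E$. $$\mathcal D(W)=\{D:\ Q_wD=\Lambda_w(D)Q_w \text{ for some }\Lambda_w(D)\in M_2,\ \text{for all } w\ge0\},$$ an associative unital algebra over $\mathbb C$ with identity $\mathbf I$ (generated subalgebras are taken to be unital). (The coefficients of any such $D$ are automatically polynomials with $\deg F_i\le i$.) The operators: $$D_1=\partial^2\begin{pmatrix} x^2 & x \\ -x & -1 \end{pmatrix}+\partial\begin{pmatrix} (n+2)x & n-p+2 \\ -p & 0 \end{pmatrix}+\begin{pmatrix}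 p(n-p+1) & 0 \\ 0 & 0 \end{pmatrix},$$ $$D_2=\partial^2\begin{pmatrix} -1 & -x \\ x & x^2 \end{pmatrix}+\partial\begin{pmatrix} 0 & p-n \\ p+2 & (n+2)x \end{pmatrix}+\begin{pmatrix} 0 & 0 \\ 0 & (p+1)(n-p) \end{pmatrix},$$ $$D_3=\partial^2\begin{pmatrix} -x & -1 \\ x^2 & x \end{pmatrix}+\partial\begin{pmatrix} -p & 0 \\ 2(p+1)x & p+2 \end{pmatrix}+\begin{pmatrix} 0 & 0 \\ p(p+1) & 0 \end{pmatrix},$$ $$D_4=\partial^2\begin{pmatrix} x & x^2 \\ -1 & -x \end{pmatrix}+\partial\begin{pmatrix} n-p+2 & 2(n-p+1)x \\ 0 & p-n \end{pmatrix}+\begin{pmatrix} 0 & (n-p)(n-p+1) \\ 0 & 0 \end{pmatrix}.$$ *)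

theory Defs
  imports
    "HOL-Analysis.Analysis"
    "HOL-Computational_Algebra.Polynomial"
    "HOL-Library.Function_Algebras"
begin

text \<open>
  Elements of $M_2[x]$ are represented as matrices of polynomials, so that the
  noncommutative product is the matrix product \<open>**\<close>; the operation \<open>*\<close> on the
  library type of vectors is componentwise and is not used for matrices here.
\<close>

type_synonym cmat = "complex^2^2"
type_synonym mpoly = "complex poly^2^2"

definition mat2 :: "'a::zero \<Rightarrow> 'a \<Rightarrow> 'a \<Rightarrow> 'a \<Rightarrow> 'a^2^2" where
  "mat2 a b c d = vector [vector [a, b], vector [c, d]]"

definition conj_transpose :: "cmat \<Rightarrow> cmat" where
  "conj_transpose T = transpose (map_matrix cnj T)"

definition mpoly_const :: "cmat \<Rightarrow> mpoly" where
  "mpoly_const A = map_matrix (\<lambda>a. [:a:]) A"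

definition mpoly_eval :: "mpoly \<Rightarrow> real \<Rightarrow> cmat" where
  "mpoly_eval P x = map_matrix (\<lambda>q. poly q (complex_of_real x)) P"

definition mpoly_deriv :: "mpoly \<Rightarrow> mpoly" where
  "mpoly_deriv P = map_matrix pderiv P"

definition mpoly_monic :: "nat \<Rightarrow> mpoly \<Rightarrow> bool" where
  "mpoly_monic w P \<longleftrightarrow>
     (\<forall>i j. degree (P $ i $ j) \<le> w) \<and> map_matrix (\<lambda>q. coeff q w) P = mat 1"

definition W :: "real \<Rightarrow> real \<Rightarrow> real \<Rightarrow> cmat" where
  "W p n x = (1 - x\<^sup>2) powr (n / 2 - 1) *\<^sub>R
     map_matrix complex_of_real
       (mat2 (p * x\<^sup>2 + n - p) (- n * x)
             (- n * x)         ((n - p) * x\<^sup>2 + p))"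

definition mform :: "(real \<Rightarrow> cmat) \<Rightarrow> mpoly \<Rightarrow> mpoly \<Rightarrow> cmat" where
  "mform V P Q =
     (LINT x:{-1..1}|lborel. mpoly_eval P x ** V x ** conj_transpose (mpoly_eval Q x))"

definition monic_orthogonal :: "(real \<Rightarrow> cmat) \<Rightarrow> (nat \<Rightarrow> mpoly) \<Rightarrow> bool" where
  "monic_orthogonal V Q \<longleftrightarrow>
     (\<forall>w. mpoly_monic w (Q w)) \<and> (\<forall>w w'. w \<noteq> w' \<longrightarrow> mform V (Q w) (Q w') = 0)"

definition mop :: "(real \<Rightarrow> cmat) \<Rightarrow> nat \<Rightarrow> mpoly" where
  "mop V = (THE Q. monic_orthogonal V Q)"

text \<open>
  A differential operator $\sum_i \partial^i F_i$ with $F_i \in M_2[x]$ is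
  identified with the map $P \mapsto \sum_i \partial^i(P) F_i$ on $M_2[x]$ that it
  induces.  This loses nothing, since the values at $I, xI, x^2I, \dots$ determine
  $F_0, F_1, F_2, \dots$ successively.
\<close>

type_synonym operator = "mpoly \<Rightarrow> mpoly"

definition diffop :: "mpoly list \<Rightarrow> operator" where
  "diffop Fs P = (\<Sum>i<length Fs. (mpoly_deriv ^^ i) P ** Fs ! i)"

text \<open>
  Operators act on the right, $P(DE) = (PD)E$, so products are compositions in
  reversed order.  Sums of operators are the pointwise sums \<open>D + E\<close>; the pointwise
  product of functions is not used.
\<close>

definition op_prod :: "operator \<Rightarrow> operator \<Rightarrow> operator" where
  "op_prod D E = E \<circ> D"

definition op_scale :: "complex \<Rightarrow> operator \<Rightarrow> operator" where
  "op_scale c D = (\<lambda>P. map_matrix (smult c) (D P))"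

definition subalgebra :: "operator set \<Rightarrow> bool" where
  "subalgebra A \<longleftrightarrow>
     id \<in> A \<and>
     (\<forall>D\<in>A. \<forall>E\<in>A. D + E \<in> A \<and> op_prod D E \<in> A) \<and>
     (\<forall>c. \<forall>D\<in>A. op_scale c D \<in> A)"

definition generated_algebra :: "operator set \<Rightarrow> operator set" where
  "generated_algebra S = subalgebra hull S"

definition diff_algebra :: "(real \<Rightarrow> cmat) \<Rightarrow> operator set" where
  "diff_algebra V =
     {D. (\<exists>Fs. D = diffop Fs) \<and>
         (\<forall>w. \<exists>\<Lambda>. D (mop V w) = mpoly_const \<Lambda> ** mop V w)}"

definition rmat2 :: "real poly \<Rightarrow> real poly \<Rightarrow> real poly \<Rightarrow> real poly \<Rightarrow> mpoly" where
  "rmat2 a b c d = map_matrix (map_poly complex_of_real) (mat2 a b c d)"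

text \<open>
  The coefficient lists start with the term of order zero, and \<open>[:a, b, c:]\<close> is the
  polynomial $a + bx + cx^2$.
\<close>

definition D1 :: "real \<Rightarrow> real \<Rightarrow> operator" where
  "D1 p n = diffop
     [rmat2 [:p * (n - p + 1):] 0
            0                   0,
      rmat2 [:0, n + 2:] [:n - p + 2:]
            [:- p:]      0,
      rmat2 [:0, 0, 1:] [:0, 1:]
            [:0, -1:]   [:-1:]]"

definition D2 :: "real \<Rightarrow> real \<Rightarrow> operator" where
  "D2 p n = diffop
     [rmat2 0 0
            0 [:(p + 1) * (n - p):],
      rmat2 0         [:p - n:]
            [:p + 2:] [:0, n + 2:],
      rmat2 [:-1:]   [:0, -1:]
            [:0, 1:] [:0, 0, 1:]]"

definition D3 :: "real \<Rightarrow> real \<Rightarrow> operator" where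
  "D3 p n = diffop
     [rmat2 0               0
            [:p * (p + 1):] 0,
      rmat2 [:- p:]              0
            [:0, 2 * (p + 1):]   [:p + 2:],
      rmat2 [:0, -1:]   [:-1:]
            [:0, 0, 1:] [:0, 1:]]"

definition D4 :: "real \<Rightarrow> real \<Rightarrow> operator" where
  "D4 p n = diffop
     [rmat2 0 [:(n - p) * (n - p + 1):]
            0 0,
      rmat2 [:n - p + 2:] [:0, 2 * (n - p + 1):]
            0             [:p - n:],
      rmat2 [:0, 1:] [:0, 0, 1:]
            [:-1:]   [:0, -1:]]"

end

theory Submission
  imports Defs
begin

text \<open>
  Write $R_1f = (xf'+pf,\, f')$, $R_2f = (f',\, xf'+(n-p)f)$, and let $C_w$ be the monic Gegenbauer
  polynomials, $(x^2-1)C_w''+(n+2)xC_w' = t\,C_w$ with $t = w(w+n+1)$.  The rows of the orthogonal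
  polynomial $Q_w$ are $R_1C_w/a$ and $R_2C_w/b$, where $a = w+p$ and $b = w+n-p$, and the eigenvalues of
  $D_1,\dots,D_4$ are $a(b+1)E_{11}$, $(a+1)b\,E_{22}$, $a(a+1)E_{21}$, $b(b+1)E_{12}$.  Here
  $a(b+1)$ and $(a+1)b$ differ from $t$ by distinct constants.

  Composing an arbitrary $D \in \mathcal D(W)$ with $R_k$ and with left inverses of the $R_k$ up to
  eigenvalues gives scalar differential operators diagonalised by the $C_w$.  Evaluating them at the
  singular point $x = 1$ shows that their eigenvalues are polynomials in $t$.  Since $\Lambda_w(D)$ is
  also polynomial in $w$, its entries are forced to be $q_{11}(t)$, $b(b+1)q_{12}(t)$,
  $a(a+1)q_{21}(t)$, $q_{22}(t)$.  Subtracting an operator generated by $D_1,\dots,D_4$ leaves the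
  constant eigenvalue $\mathrm{diag}(c,d)$, and $c = d$ because $R_1\psi = R_2\varphi$ has a nonzero
  power series solution.  Finally, with $X = D_1+D_2$, $Y = D_3+D_4$ and $k = n-2p \neq 0$ one has
  $2kD_1 = kX-X^2+Y^2$ and $kD_4 = YD_2-D_1Y$.
\<close>

section \<open>Differential operators on matrix polynomials\<close>

lemma mat2_nth [simp]:
  "mat2 a b c d $ 1 $ 1 = a" "mat2 a b c d $ 1 $ 2 = b"
  "mat2 a b c d $ 2 $ 1 = c" "mat2 a b c d $ 2 $ 2 = d"
  by (simp_all add: mat2_def)

lemma matrix2_eqI:
  fixes A B :: "'a^2^2"
  assumes "A $ 1 $ 1 = B $ 1 $ 1" "A $ 1 $ 2 = B $ 1 $ 2"
    "A $ 2 $ 1 = B $ 2 $ 1" "A $ 2 $ 2 = B $ 2 $ 2"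
  shows "A = B"
  using assms by (simp add: vec_eq_iff forall_2)

lemma matrix2_mult_nth:
  fixes A B :: "'a::semiring_1^2^2"
  shows "(A ** B) $ i $ j = A $ i $ 1 * B $ 1 $ j + A $ i $ 2 * B $ 2 $ j"
  by (simp add: matrix_matrix_mult_def sum_2)

lemma matrix2_add_mult:
  fixes A B C :: "'a::semiring_1^2^2"
  shows "(A + B) ** C = A ** C + B ** C"
  by (rule matrix2_eqI) (simp_all add: matrix2_mult_nth algebra_simps)

lemma map_matrix_nth [simp]: "map_matrix f A $ i $ j = f (A $ i $ j)"
  by (simp add: map_matrix_def)

lemma mpoly_const_nth [simp]: "mpoly_const A $ i $ j = [:A $ i $ j:]"
  by (simp add: mpoly_const_def)

lemma mpoly_deriv_funpow_nth: "(mpoly_deriv ^^ k) P $ i $ j = (pderiv ^^ k) (P $ i $ j)"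
  by (induction k) (simp_all add: mpoly_deriv_def)

lemma mpoly_const_mult: "mpoly_const (A ** B) = mpoly_const A ** mpoly_const B"
  by (rule matrix2_eqI) (simp_all add: matrix2_mult_nth)

lemma mpoly_const_add: "mpoly_const (A + B) = mpoly_const A + mpoly_const B"
  by (rule matrix2_eqI) simp_all

lemma mpoly_const_one [simp]: "mpoly_const (mat 1) = mat 1"
  by (rule matrix2_eqI) (simp_all add: mat_def)

lemma rmat2_nth [simp]:
  "rmat2 a b c d $ 1 $ 1 = map_poly of_real a" "rmat2 a b c d $ 1 $ 2 = map_poly of_real b"
  "rmat2 a b c d $ 2 $ 1 = map_poly of_real c" "rmat2 a b c d $ 2 $ 2 = map_poly of_real d"
  by (simp_all add: rmat2_def)

lemma diffop_nth:
  "diffop Fs P $ i $ j = (\<Sum>k<length Fs. (pderiv ^^ k) (P $ i $ 1) * Fs ! k $ 1 $ j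
     + (pderiv ^^ k) (P $ i $ 2) * Fs ! k $ 2 $ j)"
  by (simp add: diffop_def matrix2_mult_nth mpoly_deriv_funpow_nth)

text \<open>Operators act from the right, so they commute with constant left factors. This is all
  that is needed to carry eigenvalue identities from a monic sequence to all of M_2[x].\<close>

definition left_linear :: "operator \<Rightarrow> bool" where
  "left_linear D \<longleftrightarrow> (\<forall>P Q. D (P + Q) = D P + D Q) \<and>
     (\<forall>A P. D (mpoly_const A ** P) = mpoly_const A ** D P)"

lemma left_linear_add: "left_linear D \<Longrightarrow> D (P + Q) = D P + D Q"
  and left_linear_mult: "left_linear D \<Longrightarrow> D (mpoly_const A ** P) = mpoly_const A ** D P"
  by (simp_all add: left_linear_def)

lemma left_linear_0: "left_linear D \<Longrightarrow> D 0 = 0"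
  using left_linear_add[of D 0 0] by simp

lemma left_linear_diff: "left_linear D \<Longrightarrow> D (P - Q) = D P - D Q"
  using left_linear_add[of D "P - Q" Q] by simp

lemma mpoly_deriv_funpow_add:
  "(mpoly_deriv ^^ k) (P + Q) = (mpoly_deriv ^^ k) P + (mpoly_deriv ^^ k) Q"
  by (rule matrix2_eqI) (simp_all add: mpoly_deriv_funpow_nth higher_pderiv_add)

lemma mpoly_deriv_funpow_const_mult:
  "(mpoly_deriv ^^ k) (mpoly_const A ** P) = mpoly_const A ** (mpoly_deriv ^^ k) P"
  by (rule matrix2_eqI)
    (simp_all add: mpoly_deriv_funpow_nth higher_pderiv_add higher_pderiv_smult matrix2_mult_nth)

lemma matrix_mult_sum_right: "(A::'a::semiring_1^2^2) ** (\<Sum>i\<in>I. f i :: 'a^2^2) = (\<Sum>i\<in>I. A ** f i)"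
  by (induction I rule: infinite_finite_induct) (simp_all add: matrix_add_ldistrib)

lemma matrix_mult_sum_left: "(\<Sum>i\<in>I. f i :: 'a::semiring_1^2^2) ** (A::'a^2^2) = (\<Sum>i\<in>I. f i ** A)"
  by (induction I rule: infinite_finite_induct) (simp_all add: matrix2_add_mult)

lemma left_linear_diffop: "left_linear (diffop Fs)"
  by (simp add: left_linear_def diffop_def mpoly_deriv_funpow_add mpoly_deriv_funpow_const_mult
      matrix2_add_mult sum.distrib matrix_mult_sum_right matrix_mul_assoc)

section \<open>Closure of the differential operators under the algebra operations\<close>

definition diffops :: "operator set" where
  "diffops = range diffop"

lemma diffop_append_zeros:
  "diffop (Fs @ replicate k 0) = diffop Fs"
proof -
  have "(\<Sum>i<length Fs + k. (mpoly_deriv ^^ i) P ** (Fs @ replicate k 0) ! i) =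
    (\<Sum>i<length Fs. (mpoly_deriv ^^ i) P ** Fs ! i)" for P
    by (rule sum.mono_neutral_cong_right) (auto simp: nth_append)
  then show ?thesis by (simp add: diffop_def fun_eq_iff)
qed

lemma diffops_add: assumes "D \<in> diffops" "E \<in> diffops" shows "D + E \<in> diffops"
proof -
  obtain Fs Gs where "D = diffop Fs" "E = diffop Gs"
    using assms by (auto simp: diffops_def)
  moreover define m where "m = max (length Fs) (length Gs)"
  define Fs' Gs' where "Fs' = Fs @ replicate (m - length Fs) 0"
    and "Gs' = Gs @ replicate (m - length Gs) 0"
  ultimately have "D = diffop Fs'" "E = diffop Gs'" "length Fs' = m" "length Gs' = m"
    by (simp_all add: diffop_append_zeros m_def)
  then have "D + E = diffop (map2 (+) Fs' Gs')"
    by (simp add: fun_eq_iff diffop_def matrix_add_ldistrib sum.distrib)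
  then show ?thesis by (simp add: diffops_def)
qed

lemma diffops_zero: "(\<lambda>P. 0) \<in> diffops"
proof -
  have "(\<lambda>P. 0) = diffop []" by (simp add: fun_eq_iff diffop_def)
  then show ?thesis by (simp add: diffops_def)
qed

lemma diffops_sum:
  assumes "\<And>i. i \<in> I \<Longrightarrow> D i \<in> diffops"
  shows "(\<lambda>P. \<Sum>i\<in>I. D i P) \<in> diffops"
  using assms
proof (induction I rule: infinite_finite_induct)
  case (insert i I)
  have "D i + (\<lambda>P. \<Sum>i\<in>I. D i P) \<in> diffops"
    using insert by (intro diffops_add) auto
  then show ?case using insert by (simp add: plus_fun_def)
qed (simp_all add: diffops_zero)

lemma diffops_monom: "(\<lambda>P. (mpoly_deriv ^^ k) P ** F) \<in> diffops"
proof -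
  have "(\<Sum>i<Suc k. (mpoly_deriv ^^ i) P ** (replicate k 0 @ [F]) ! i) = (mpoly_deriv ^^ k) P ** F" for P
    by (simp add: nth_append)
  then have "diffop (replicate k 0 @ [F]) = (\<lambda>P. (mpoly_deriv ^^ k) P ** F)"
    by (simp add: diffop_def fun_eq_iff)
  then show ?thesis unfolding diffops_def by (metis rangeI)
qed

lemma diffops_mult_right: "D \<in> diffops \<Longrightarrow> (\<lambda>P. D P ** F) \<in> diffops"
proof -
  assume "D \<in> diffops"
  then obtain Fs where "D = diffop Fs" by (auto simp: diffops_def)
  then have "(\<lambda>P. D P ** F) = diffop (map (\<lambda>G. G ** F) Fs)"
    by (simp add: fun_eq_iff diffop_def matrix_mult_sum_left matrix_mul_assoc)
  then show ?thesis by (simp add: diffops_def)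
qed

lemma mpoly_deriv_mult: "mpoly_deriv (P ** Q) = mpoly_deriv P ** Q + P ** mpoly_deriv Q"
  by (rule matrix2_eqI) (simp_all add: mpoly_deriv_def matrix2_mult_nth pderiv_add pderiv_mult)

lemma mpoly_deriv_sum: "mpoly_deriv (\<Sum>i\<in>I. f i) = (\<Sum>i\<in>I. mpoly_deriv (f i))"
proof (induction I rule: infinite_finite_induct)
  case (insert i I) then show ?case using mpoly_deriv_funpow_add[of 1] by simp
qed (simp_all add: vec_eq_iff mpoly_deriv_def)

lemma diffops_deriv: "D \<in> diffops \<Longrightarrow> (\<lambda>P. mpoly_deriv (D P)) \<in> diffops"
proof -
  assume "D \<in> diffops"
  then obtain Fs where "D = diffop Fs" by (auto simp: diffops_def)
  then have "(\<lambda>P. mpoly_deriv (D P)) =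
    (\<lambda>P. \<Sum>i<length Fs. (mpoly_deriv ^^ Suc i) P ** Fs ! i) +
    (\<lambda>P. \<Sum>i<length Fs. (mpoly_deriv ^^ i) P ** mpoly_deriv (Fs ! i))"
    by (simp add: fun_eq_iff diffop_def mpoly_deriv_sum mpoly_deriv_mult sum.distrib)
  also have "\<dots> \<in> diffops"
    by (intro diffops_add diffops_sum diffops_monom)
  finally show ?thesis .
qed

text \<open>By the Leibniz rule every derivative of \<open>D P\<close> is again a differential
  operator in \<open>P\<close>; \<open>E\<close> multiplies these by fixed matrices and adds them
  up.\<close>

lemma diffops_comp: assumes "D \<in> diffops" "E \<in> diffops" shows "op_prod D E \<in> diffops"
proof -
  obtain Gs where E: "E = diffop Gs" using assms by (auto simp: diffops_def)
  have "(\<lambda>P. (mpoly_deriv ^^ k) (D P)) \<in> diffops" for k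
    by (induction k) (simp_all add: assms diffops_deriv)
  then have "(\<lambda>P. \<Sum>i<length Gs. (mpoly_deriv ^^ i) (D P) ** Gs ! i) \<in> diffops"
    by (intro diffops_sum diffops_mult_right)
  then show ?thesis by (simp add: E op_prod_def diffop_def o_def)
qed

lemma diffops_scale: assumes "D \<in> diffops" shows "op_scale c D \<in> diffops"
proof -
  have "op_scale c D = (\<lambda>P. D P ** mpoly_const (mat2 c 0 0 c))"
    by (rule ext, rule matrix2_eqI) (simp_all add: op_scale_def matrix2_mult_nth)
  then show ?thesis using diffops_mult_right[OF assms] by simp
qed

lemma diffops_id: "id \<in> diffops"
  using diffops_monom[of 0 "mat 1"] by (simp add: id_def)

lemma left_linear_diffops: "D \<in> diffops \<Longrightarrow> left_linear D"
  by (auto simp: diffops_def left_linear_diffop)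

section \<open>Gegenbauer polynomials\<close>

lemma map_poly_of_real_mult:
  "map_poly complex_of_real (f * g) = map_poly of_real f * map_poly of_real g"
  by (rule poly_eqI) (simp add: coeff_map_poly coeff_mult)

lemma map_poly_of_real_pderiv:
  "map_poly complex_of_real (pderiv f) = pderiv (map_poly of_real f)"
  by (rule poly_eqI) (simp add: coeff_map_poly coeff_pderiv)

lemma map_poly_of_real_add:
  "map_poly complex_of_real (f + g) = map_poly of_real f + map_poly of_real g"
  by (rule poly_eqI) (simp add: coeff_map_poly)

lemma map_poly_of_real_smult:
  "map_poly complex_of_real (smult c f) = smult (of_real c) (map_poly of_real f)"
  by (rule poly_eqI) (simp add: coeff_map_poly)

lemma poly_map_poly_of_real: "poly (map_poly complex_of_real f) (of_real x) = of_real (poly f x)"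
  by (induction f) (simp_all add: map_poly_pCons)

lemma complex_poly_ext:
  fixes f g :: "complex poly"
  assumes "\<And>x. poly f x = poly g x" shows "f = g"
  using assms by (simp add: poly_eq_poly_eq_iff[symmetric] fun_eq_iff)

definition euler :: "complex \<Rightarrow> complex poly \<Rightarrow> complex poly" where
  "euler c f = [:0, 1:] * pderiv f + smult c f"

lemma coeff_euler [simp]: "coeff (euler c f) k = (of_nat k + c) * coeff f k"
  by (cases k) (simp_all add: euler_def coeff_pderiv algebra_simps)

lemma euler_add: "euler c (f + g) = euler c f + euler c g"
  and euler_smult: "euler c (smult d f) = smult d (euler c f)"
  by (rule poly_eqI; simp add: coeff_pderiv algebra_simps)+

lemma euler_0 [simp]: "euler c 0 = 0"
  by (simp add: euler_def)

locale gegenbauer_weight =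
  fixes n p :: real
  assumes p_pos: "0 < p" and p_less: "p < n / 2"
begin

abbreviation "cn \<equiv> complex_of_real n"
abbreviation "cp \<equiv> complex_of_real p"

lemma n_pos: "0 < n" and np_pos: "0 < n - p"
  using p_pos p_less by auto

section \<open>Gegenbauer polynomials from their Taylor expansion at x = 1\<close>

definition gegenbauer_op :: "complex poly \<Rightarrow> complex poly" where
  "gegenbauer_op f = [:-1, 0, 1:] * pderiv (pderiv f) + smult (cn + 2) ([:0, 1:] * pderiv f)"

definition geg_eigenvalue :: "nat \<Rightarrow> real" where
  "geg_eigenvalue w = w * (w + n + 1)"

text \<open>With x = 1 + s the Gegenbauer equation becomes s(s+2)y'' + (n+2)(s+1)y' = ty, a two-term
  recursion for the coefficients of y. The product solves it with y(0) = 1 and terminates through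
  its factor j = w.\<close>

definition geg_coeff :: "nat \<Rightarrow> nat \<Rightarrow> real" where
  "geg_coeff w k = (\<Prod>j<k. (geg_eigenvalue w - geg_eigenvalue j) / ((j + 1) * (2 * j + n + 2)))"

lemma geg_eigenvalue_less: "j < w \<Longrightarrow> geg_eigenvalue j < geg_eigenvalue w"
  unfolding geg_eigenvalue_def using n_pos by (intro mult_strict_mono) auto

lemma geg_coeff_nonzero: assumes "k \<le> w" shows "geg_coeff w k \<noteq> 0"
proof -
  have "(geg_eigenvalue w - geg_eigenvalue j) / ((j + 1) * (2 * j + n + 2)) > 0" if "j < k" for j
    using that assms n_pos geg_eigenvalue_less[of j w] by (intro divide_pos_pos mult_pos_pos) auto
  then show ?thesis
    unfolding geg_coeff_def by (intro less_imp_neq[symmetric] prod_pos) auto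
qed

lemma geg_coeff_eq_0: "w < k \<Longrightarrow> geg_coeff w k = 0"
  by (auto simp: geg_coeff_def)

lemma geg_coeff_Suc:
  "(real k + 1) * (2 * k + n + 2) * geg_coeff w (Suc k) =
    (geg_eigenvalue w - geg_eigenvalue k) * geg_coeff w k"
proof -
  have "(real k + 1) * (2 * k + n + 2) \<noteq> 0" using n_pos by simp
  then show ?thesis by (simp add: geg_coeff_def del: mult_eq_0_iff)
qed

definition geg_at_1 :: "nat \<Rightarrow> real poly" where
  "geg_at_1 w = (\<Sum>k\<le>w. monom (geg_coeff w k) k)"

lemma coeff_geg_at_1: "coeff (geg_at_1 w) k = geg_coeff w k"
  by (auto simp: geg_at_1_def coeff_sum geg_coeff_eq_0 not_le)

lemma geg_at_1_ode:
  "[:0, 2, 1:] * pderiv (pderiv (geg_at_1 w)) + smult (n + 2) ([:1, 1:] * pderiv (geg_at_1 w))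
    = smult (geg_eigenvalue w) (geg_at_1 w)"
proof (rule poly_eqI)
  fix k
  have "coeff ([:0, 2, 1:] * pderiv (pderiv (geg_at_1 w)) + smult (n + 2) ([:1, 1:] * pderiv (geg_at_1 w))) k
    = (real k + 1) * (2 * k + n + 2) * geg_coeff w (Suc k) + geg_eigenvalue k * geg_coeff w k"
    by (cases k; cases "k - 1")
      (auto simp: coeff_pderiv coeff_geg_at_1 geg_eigenvalue_def algebra_simps)
  also have "\<dots> = geg_eigenvalue w * geg_coeff w k"
    unfolding geg_coeff_Suc by (simp add: algebra_simps)
  finally show "coeff ([:0, 2, 1:] * pderiv (pderiv (geg_at_1 w)) + smult (n + 2) ([:1, 1:] * pderiv (geg_at_1 w))) k
    = coeff (smult (geg_eigenvalue w) (geg_at_1 w)) k"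
    by (simp add: coeff_geg_at_1)
qed

definition geg_real :: "nat \<Rightarrow> real poly" where
  "geg_real w = smult (1 / geg_coeff w w) (geg_at_1 w \<circ>\<^sub>p [:-1, 1:])"

definition geg :: "nat \<Rightarrow> complex poly" where
  "geg w = map_poly of_real (geg_real w)"

lemma degree_geg_at_1: "degree (geg_at_1 w) = w"
proof (rule antisym)
  show "degree (geg_at_1 w) \<le> w"
    by (rule degree_le) (simp add: coeff_geg_at_1 geg_coeff_eq_0)
  show "w \<le> degree (geg_at_1 w)"
    by (rule le_degree) (simp add: coeff_geg_at_1 geg_coeff_nonzero)
qed

lemma degree_geg_real: "degree (geg_real w) = w"
  by (simp add: geg_real_def degree_pcompose degree_geg_at_1 geg_coeff_nonzero)

lemma coeff_geg_top: "coeff (geg w) w = 1"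
proof -
  have "lead_coeff (geg_at_1 w \<circ>\<^sub>p [:-1, 1:]) = geg_coeff w w"
    by (subst lead_coeff_comp) (simp_all add: degree_geg_at_1 coeff_geg_at_1)
  then have "coeff (geg_at_1 w \<circ>\<^sub>p [:-1, 1:]) w = geg_coeff w w"
    by (simp add: degree_pcompose degree_geg_at_1)
  then show ?thesis
    by (simp add: geg_def geg_real_def coeff_map_poly geg_coeff_nonzero)
qed

lemma coeff_geg_eq_0: "w < k \<Longrightarrow> coeff (geg w) k = 0"
  by (simp add: geg_def coeff_map_poly coeff_eq_0 degree_geg_real)

text \<open>The expansion at 1 has constant term 1 before normalisation. This value is divided out
  later, when eigenvalues are read off at x = 1.\<close>

lemma poly_geg_1: "poly (geg w) 1 \<noteq> 0"
proof -
  have "poly (geg_at_1 w) 0 = 1"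
    by (simp add: poly_0_coeff_0 coeff_geg_at_1 geg_coeff_def)
  then have "poly (geg_real w) 1 \<noteq> 0"
    by (simp add: geg_real_def poly_pcompose geg_coeff_nonzero)
  moreover have "poly (geg w) (of_real 1) = of_real (poly (geg_real w) 1)"
    unfolding geg_def by (rule poly_map_poly_of_real)
  ultimately show ?thesis by simp
qed

lemma geg_ode: "gegenbauer_op (geg w) = smult (of_real (geg_eigenvalue w)) (geg w)"
proof -
  let ?L = "[:-1, 1:] :: real poly"
  have d: "pderiv (f \<circ>\<^sub>p ?L) = pderiv f \<circ>\<^sub>p ?L" for f
    by (simp add: pderiv_pcompose pderiv_pCons)
  have "([:0, 2, 1:] * pderiv (pderiv (geg_at_1 w)) + smult (n + 2) ([:1, 1:] * pderiv (geg_at_1 w))) \<circ>\<^sub>p ?L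
    = smult (geg_eigenvalue w) (geg_at_1 w) \<circ>\<^sub>p ?L"
    by (simp only: geg_at_1_ode)
  then have "[:-1, 0, 1:] * pderiv (pderiv (geg_at_1 w \<circ>\<^sub>p ?L)) + smult (n + 2) ([:0, 1:] * pderiv (geg_at_1 w \<circ>\<^sub>p ?L))
    = smult (geg_eigenvalue w) (geg_at_1 w \<circ>\<^sub>p ?L)"
    unfolding d by (simp only: pcompose_add pcompose_mult pcompose_smult) (simp add: pcompose_pCons)
  then have "smult (1 / geg_coeff w w) ([:-1, 0, 1:] * pderiv (pderiv (geg_at_1 w \<circ>\<^sub>p ?L)) + smult (n + 2) ([:0, 1:] * pderiv (geg_at_1 w \<circ>\<^sub>p ?L)))
    = smult (1 / geg_coeff w w) (smult (geg_eigenvalue w) (geg_at_1 w \<circ>\<^sub>p ?L))"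
    by simp
  then have "[:-1, 0, 1:] * pderiv (pderiv (geg_real w)) + smult (n + 2) ([:0, 1:] * pderiv (geg_real w))
    = smult (geg_eigenvalue w) (geg_real w)"
    by (simp add: geg_real_def pderiv_smult smult_add_right mult.commute)
  then have "map_poly complex_of_real ([:-1, 0, 1:] * pderiv (pderiv (geg_real w)) + smult (n + 2) ([:0, 1:] * pderiv (geg_real w)))
    = map_poly of_real (smult (geg_eigenvalue w) (geg_real w))"
    by simp
  then show ?thesis
    unfolding gegenbauer_op_def geg_def
      map_poly_of_real_add map_poly_of_real_mult map_poly_of_real_smult map_poly_of_real_pderiv
    by (simp add: map_poly_pCons)
qed

text \<open>The leading coefficients of $D_1,\dots,D_4$ have rank one, so that these operators factor through
  scalar polynomials.  Let $R_1f$ and $R_2g$ be the rows of \<^term>\<open>lift f g\<close> and let $S_1$, $S_2$ be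
  the maps \<^term>\<open>drop1\<close>, \<^term>\<open>drop2\<close> on rows.  Then $D_1$ is $S_1$ followed by $R_1$, $D_2$ is $S_2$
  followed by $R_2$, $D_3$ is $S_2$ followed by $R_1$, and $D_4$ is $S_1$ followed by $R_2$.\<close>

definition lift :: "complex poly \<Rightarrow> complex poly \<Rightarrow> mpoly" where
  "lift f g = mat2 (euler cp f) (pderiv f) (pderiv g) (euler (cn - cp) g)"

lemma lift_nth:
  "lift f g $ 1 $ 1 = euler cp f" "lift f g $ 1 $ 2 = pderiv f"
  "lift f g $ 2 $ 1 = pderiv g" "lift f g $ 2 $ 2 = euler (cn - cp) g"
  by (simp_all add: lift_def)

definition drop1 :: "mpoly \<Rightarrow> 2 \<Rightarrow> complex poly" where
  "drop1 P i = euler (cn - cp + 1) (P $ i $ 1) - pderiv (P $ i $ 2)"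

definition drop2 :: "mpoly \<Rightarrow> 2 \<Rightarrow> complex poly" where
  "drop2 P i = euler (cp + 1) (P $ i $ 2) - pderiv (P $ i $ 1)"

text \<open>The mixed compositions vanish because d/dx (x d/dx + c) = (x d/dx + c + 1) d/dx; the
  matching ones reproduce the Gegenbauer operator up to a constant.\<close>

lemma drop1_lift: "drop1 (lift f g) 1 = gegenbauer_op f + smult (cp * (cn - cp + 1)) f"
  "drop1 (lift f g) 2 = 0"
  and drop2_lift: "drop2 (lift f g) 1 = 0"
  "drop2 (lift f g) 2 = gegenbauer_op g + smult ((cp + 1) * (cn - cp)) g"
proof -
  note defs = drop1_def drop2_def lift_def euler_def gegenbauer_op_def pderiv_add pderiv_mult
    pderiv_smult pderiv_pCons
  show "drop1 (lift f g) 1 = gegenbauer_op f + smult (cp * (cn - cp + 1)) f"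
    by (rule complex_poly_ext, simp add: defs, algebra)
  show "drop1 (lift f g) 2 = 0"
    by (rule complex_poly_ext, simp add: defs, algebra)
  show "drop2 (lift f g) 1 = 0"
    by (rule complex_poly_ext, simp add: defs, algebra)
  show "drop2 (lift f g) 2 = gegenbauer_op g + smult ((cp + 1) * (cn - cp)) g"
    by (rule complex_poly_ext, simp add: defs, algebra)
qed

lemma D1_nth:
  "D1 p n P $ i $ 1 = euler cp (drop1 P i)" "D1 p n P $ i $ 2 = pderiv (drop1 P i)"
  by (rule complex_poly_ext, simp add: D1_def diffop_nth map_poly_pCons lessThan_Suc drop1_def
      euler_def pderiv_add pderiv_diff pderiv_mult pderiv_smult pderiv_pCons, algebra)+

lemma D2_nth:
  "D2 p n P $ i $ 1 = pderiv (drop2 P i)" "D2 p n P $ i $ 2 = euler (cn - cp) (drop2 P i)"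
  by (rule complex_poly_ext, simp add: D2_def diffop_nth map_poly_pCons lessThan_Suc drop2_def
      euler_def pderiv_add pderiv_diff pderiv_mult pderiv_smult pderiv_pCons, algebra)+

lemma D3_nth:
  "D3 p n P $ i $ 1 = euler cp (drop2 P i)" "D3 p n P $ i $ 2 = pderiv (drop2 P i)"
  by (rule complex_poly_ext, simp add: D3_def diffop_nth map_poly_pCons lessThan_Suc drop2_def
      euler_def pderiv_add pderiv_diff pderiv_mult pderiv_smult pderiv_pCons, algebra)+

lemma D4_nth:
  "D4 p n P $ i $ 1 = pderiv (drop1 P i)" "D4 p n P $ i $ 2 = euler (cn - cp) (drop1 P i)"
  by (rule complex_poly_ext, simp add: D4_def diffop_nth map_poly_pCons lessThan_Suc drop1_def
      euler_def pderiv_add pderiv_diff pderiv_mult pderiv_smult pderiv_pCons, algebra)+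

end

section \<open>Operators with a monic sequence of eigenpolynomials\<close>

text \<open>Phrased by vanishing coefficients so that \<open>w = 0\<close> singles out the zero
  polynomial, which starts the inductions on the degree.\<close>

definition deg_below :: "nat \<Rightarrow> mpoly \<Rightarrow> bool" where
  "deg_below w P \<longleftrightarrow> (\<forall>i j. \<forall>k\<ge>w. coeff (P $ i $ j) k = 0)"

definition mcoeff :: "nat \<Rightarrow> mpoly \<Rightarrow> cmat" where
  "mcoeff k P = map_matrix (\<lambda>q. coeff q k) P"

lemma mcoeff_nth [simp]: "mcoeff k P $ i $ j = coeff (P $ i $ j) k"
  by (simp add: mcoeff_def)

lemma mcoeff_const_mult: "mcoeff k (mpoly_const A ** P) = A ** mcoeff k P"
  by (rule matrix2_eqI) (simp_all add: matrix2_mult_nth)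

lemma mcoeff_add: "mcoeff k (P + Q) = mcoeff k P + mcoeff k Q"
  and mcoeff_diff: "mcoeff k (P - Q) = mcoeff k P - mcoeff k Q"
  by (rule matrix2_eqI; simp)+

lemma deg_below_iff: "deg_below w P \<longleftrightarrow> (\<forall>k\<ge>w. mcoeff k P = 0)"
  by (auto simp: deg_below_def vec_eq_iff)

lemma deg_below_0: "deg_below 0 P \<Longrightarrow> P = 0"
  by (simp add: deg_below_def vec_eq_iff poly_eq_iff)

lemma deg_below_ex: "\<exists>w. deg_below w P"
proof -
  have "deg_below (Suc (degree (P$1$1) + degree (P$1$2) + degree (P$2$1) + degree (P$2$2))) P"
    by (auto simp: deg_below_def forall_2 intro!: coeff_eq_0)
  then show ?thesis ..
qed

lemma deg_below_mono: "deg_below w P \<Longrightarrow> w \<le> w' \<Longrightarrow> deg_below w' P"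
  by (auto simp: deg_below_def)

lemma deg_below_add: "deg_below w P \<Longrightarrow> deg_below w Q \<Longrightarrow> deg_below w (P + Q)"
  and deg_below_const_mult: "deg_below w P \<Longrightarrow> deg_below w (mpoly_const A ** P)"
  by (simp_all add: deg_below_iff mcoeff_add mcoeff_const_mult)

lemma mpoly_monic_iff: "mpoly_monic w P \<longleftrightarrow> deg_below (Suc w) P \<and> mcoeff w P = mat 1"
proof -
  have "degree f \<le> w \<longleftrightarrow> (\<forall>k\<ge>Suc w. coeff f k = 0)" for f :: "complex poly"
    using coeff_eq_0[of f] by (auto intro!: degree_le)
  then show ?thesis by (simp add: mpoly_monic_def mcoeff_def deg_below_def)
qed

lemma monic_reduce:
  assumes "mpoly_monic w R" "deg_below (Suc w) P"
  shows "deg_below w (P - mpoly_const (mcoeff w P) ** R)"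
  unfolding deg_below_iff
proof (intro allI impI)
  fix k assume "w \<le> k"
  then consider "k = w" | "Suc w \<le> k" by linarith
  then show "mcoeff k (P - mpoly_const (mcoeff w P) ** R) = 0"
    using assms by cases (auto simp: mcoeff_diff mcoeff_const_mult mpoly_monic_iff deg_below_iff)
qed

text \<open>Removing leading terms one by one expands any matrix polynomial in the
  \<open>R w\<close> with constant left coefficients; the induction runs along this
  expansion.\<close>

lemma monic_induct:
  assumes monic: "\<And>w. mpoly_monic w (R w)"
    and zero: "S 0"
    and step: "\<And>w A P. deg_below w P \<Longrightarrow> S P \<Longrightarrow> S (mpoly_const A ** R w + P)"
  shows "S P"
proof -
  obtain w where "deg_below w P" using deg_below_ex by blast
  then show ?thesis
  proof (induction w arbitrary: P)
    case 0 then show ?case using zero deg_below_0 by blast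
  next
    case (Suc w)
    have "deg_below w (P - mpoly_const (mcoeff w P) ** R w)"
      using monic_reduce[OF monic Suc.prems] .
    from step[OF this Suc.IH[OF this], of "mcoeff w P"] show ?case by simp
  qed
qed

lemma left_linear_eqI:
  assumes "\<And>w. mpoly_monic w (R w)" "left_linear D" "left_linear E"
    "\<And>w. D (R w) = E (R w)"
  shows "D = E"
proof
  fix P show "D P = E P"
    by (induction P rule: monic_induct[OF assms(1)])
      (simp_all add: assms left_linear_add left_linear_mult left_linear_0)
qed

lemma eigen_deg_below:
  assumes "\<And>w. mpoly_monic w (R w)" "left_linear D"
    "\<And>w. D (R w) = mpoly_const (L w) ** R w"
    and "deg_below w P"
  shows "deg_below w (D P)"
  using assms(4)
proof (induction w arbitrary: P)
  case 0 then show ?case using deg_below_0[of P] by (simp add: left_linear_0 assms)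
next
  case (Suc w)
  define P' where "P' = P - mpoly_const (mcoeff w P) ** R w"
  have "deg_below w P'" unfolding P'_def
    using monic_reduce[OF assms(1) Suc.prems] .
  then have "deg_below (Suc w) (D P')" using Suc.IH deg_below_mono by (meson le_Suc_eq order_refl)
  moreover have "P = mpoly_const (mcoeff w P) ** R w + P'" by (simp add: P'_def)
  then have "D P = mpoly_const (mcoeff w P) ** (mpoly_const (L w) ** R w) + D P'"
    by (metis assms(2,3) left_linear_add left_linear_mult)
  moreover have "deg_below (Suc w) (R w)" using assms(1) by (simp add: mpoly_monic_iff)
  ultimately show ?case by (simp add: deg_below_add deg_below_const_mult)
qed

text \<open>\<open>P\<close> and \<open>R w\<close> differ by a polynomial of lower degree, and
  \<open>D\<close> does not raise degrees. Hence the eigenvalue can be computed on x^w I without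
  knowing \<open>R w\<close>.\<close>

lemma eigen_mcoeff:
  assumes "\<And>w. mpoly_monic w (R w)" "left_linear D"
    "\<And>w. D (R w) = mpoly_const (L w) ** R w"
    and "mpoly_monic w P"
  shows "mcoeff w (D P) = L w"
proof -
  define P' where "P' = P - R w"
  have "deg_below w P'"
    using monic_reduce[OF assms(1)[of w], of P] assms(4) by (simp add: P'_def mpoly_monic_iff)
  then have "mcoeff w (D P') = 0"
    using eigen_deg_below[OF assms(1-3)] by (simp add: deg_below_iff)
  moreover have "P = R w + P'" by (simp add: P'_def)
  then have "D P = mpoly_const (L w) ** R w + D P'"
    by (metis assms(2,3) left_linear_add)
  ultimately show ?thesis
    using assms(1)[of w] by (simp add: mcoeff_add mcoeff_const_mult mpoly_monic_iff)
qed

section \<open>Polynomial dependence of the eigenvalues on w\<close>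

definition falling_poly :: "nat \<Rightarrow> complex poly" where
  "falling_poly k = (\<Prod>l<k. [:- of_nat l, 1:])"

lemma poly_falling_eq_0: "w < k \<Longrightarrow> poly (falling_poly k) (of_nat w) = 0"
  by (auto simp: falling_poly_def poly_prod)

lemma higher_pderiv_monom_falling:
  "(pderiv ^^ k) (monom 1 w) = monom (poly (falling_poly k) (of_nat w)) (w - k)"
proof (induction k)
  case (Suc k)
  show ?case
  proof (cases "k < w")
    case True
    then show ?thesis using Suc
      by (simp add: falling_poly_def pderiv_monom of_nat_diff algebra_simps)
  next
    case False
    then have "w = k \<or> w < k" by auto
    then show ?thesis using Suc False poly_falling_eq_0[of w "Suc k"]
      by (auto simp: pderiv_monom poly_falling_eq_0)
  qed
qed (simp add: falling_poly_def)

lemma diffop_mcoeff_monom: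
  "mcoeff w (diffop Fs (mat (monom 1 w))) $ i $ j =
    poly (\<Sum>k<length Fs. smult (coeff (Fs ! k $ i $ j) k) (falling_poly k)) (of_nat w)"
proof -
  \<comment> \<open>Only the coefficient of x^k in \<open>f\<close> lifts x^(w-k) back to x^w. For
    \<open>w < k\<close> the truncated exponent is harmless, since the falling factorial is
    0.\<close>
  have *: "coeff ((pderiv ^^ k) (monom 1 w) * f) w = coeff f k * poly (falling_poly k) (of_nat w)" for k f
    by (cases "k \<le> w") (auto simp: higher_pderiv_monom_falling coeff_monom_mult poly_falling_eq_0 not_le)
  have "(mat (monom 1 w) :: mpoly) $ i $ l = (if i = l then monom 1 w else 0)" for l
    by (simp add: mat_def)
  then show ?thesis
    using exhaust_2[of i] by (auto simp: diffop_nth coeff_sum * poly_sum)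
qed

lemma eigen_polynomial:
  assumes "\<And>w. mpoly_monic w (R w)" "D \<in> diffops"
    "\<And>w. D (R w) = mpoly_const (L w) ** R w"
  obtains h where "\<And>w. L w $ i $ j = poly h (of_nat w)"
proof -
  obtain Fs where D: "D = diffop Fs" using assms(2) by (auto simp: diffops_def)
  have "mpoly_monic w (mat (monom 1 w))" for w
    by (auto simp: mpoly_monic_def mat_def degree_monom_eq vec_eq_iff)
  from eigen_mcoeff[OF assms(1) left_linear_diffops[OF assms(2)] assms(3) this]
  have "L w = mcoeff w (D (mat (monom 1 w)))" for w by simp
  then show thesis
    by (intro that[of "\<Sum>k<length Fs. smult (coeff (Fs ! k $ i $ j) k) (falling_poly k)"])
      (simp only: D diffop_mcoeff_monom)
qed

section \<open>The monic sequence Q_w and the eigenvalues of D_1, ..., D_4\<close>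

context gegenbauer_weight
begin

text \<open>\<open>ea w\<close>, \<open>eb w\<close> and \<open>et w\<close> are a, b and t of the
  overview.\<close>

definition "ea w = of_nat w + cp"
definition "eb w = of_nat w + (cn - cp)"
definition "et w = complex_of_real (geg_eigenvalue w)"

lemma ea_nonzero: "ea w \<noteq> 0" "ea w + 1 \<noteq> 0" and eb_nonzero: "eb w \<noteq> 0" "eb w + 1 \<noteq> 0"
proof -
  have "ea w = of_real (w + p)" "eb w = of_real (w + (n - p))" 
    by (simp_all add: ea_def eb_def)
  moreover have "ea w + 1 = of_real (w + p + 1)" "eb w + 1 = of_real (w + (n - p) + 1)" 
    by (simp_all add: ea_def eb_def)
  ultimately show "ea w \<noteq> 0" "ea w + 1 \<noteq> 0" "eb w \<noteq> 0" "eb w + 1 \<noteq> 0"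
    using p_pos np_pos by (auto simp only: of_real_eq_0_iff)
qed

lemma et_eq: "et w = of_nat w * (of_nat w + cn + 1)"
  by (simp add: et_def geg_eigenvalue_def)

lemma et_plus: "et w + cp * (cn - cp + 1) = ea w * (eb w + 1)"
  "et w + (cp + 1) * (cn - cp) = (ea w + 1) * eb w"
  by (simp_all add: et_eq ea_def eb_def algebra_simps)

abbreviation "lift_geg w \<equiv> lift (geg w) (geg w)"

lemma drop_lift_geg:
  "drop1 (lift_geg w) 1 = smult (ea w * (eb w + 1)) (geg w)" "drop1 (lift_geg w) 2 = 0"
  "drop2 (lift_geg w) 1 = 0" "drop2 (lift_geg w) 2 = smult ((ea w + 1) * eb w) (geg w)"
  by (simp_all add: drop1_lift drop2_lift geg_ode et_plus[symmetric] et_def smult_add_left)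

definition mopQ :: "nat \<Rightarrow> mpoly" where
  "mopQ w = mpoly_const (mat2 (1 / ea w) 0 0 (1 / eb w)) ** lift_geg w"

lemma mopQ_monic: "mpoly_monic w (mopQ w)"
  unfolding mpoly_monic_iff deg_below_iff
proof (intro conjI allI impI)
  show "mcoeff w (mopQ w) = mat 1"
    using ea_nonzero[of w] eb_nonzero[of w] unfolding mopQ_def mcoeff_const_mult
    by (intro matrix2_eqI) (simp_all add: matrix2_mult_nth lift_def coeff_geg_top coeff_pderiv coeff_geg_eq_0 mat_def
        ea_def[symmetric] eb_def[symmetric])
  show "mcoeff k (mopQ w) = 0" if "Suc w \<le> k" for k
    using that unfolding mopQ_def mcoeff_const_mult
    by (intro matrix2_eqI) (simp_all add: matrix2_mult_nth lift_def coeff_pderiv coeff_geg_eq_0)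
qed

text \<open>Membership in D(W) with its eigenvalue sequence made explicit. Stating it for the
  concrete \<open>mopQ\<close> keeps the algebra free of integrals; \<open>mop_eq\<close> later
  identifies \<open>mopQ\<close> with the orthogonal sequence.\<close>

definition has_eigen :: "operator \<Rightarrow> (nat \<Rightarrow> cmat) \<Rightarrow> bool" where
  "has_eigen D L \<longleftrightarrow> D \<in> diffops \<and> (\<forall>w. D (mopQ w) = mpoly_const (L w) ** mopQ w)"

lemma lift_geg_eq: "lift_geg w = mpoly_const (mat2 (ea w) 0 0 (eb w)) ** mopQ w"
  using ea_nonzero eb_nonzero
  by (intro matrix2_eqI) (simp_all add: mopQ_def matrix2_mult_nth)

text \<open>Passing to the unnormalised rows conjugates the eigenvalue by diag(a, b).\<close>

lemma has_eigen_lift: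
  assumes "has_eigen D L"
  shows "D (lift_geg w) = mpoly_const (mat2 (L w $ 1 $ 1) (L w $ 1 $ 2 * ea w / eb w)
    (L w $ 2 $ 1 * eb w / ea w) (L w $ 2 $ 2)) ** lift_geg w" (is "_ = mpoly_const ?M ** _")
proof -
  have ll: "left_linear D" using assms by (simp add: has_eigen_def left_linear_diffops)
  have "D (lift_geg w) = mpoly_const (mat2 (ea w) 0 0 (eb w) ** L w) ** mopQ w"
    using assms unfolding lift_geg_eq left_linear_mult[OF ll]
    by (simp add: has_eigen_def mpoly_const_mult matrix_mul_assoc)
  also have "mat2 (ea w) 0 0 (eb w) ** L w = ?M ** mat2 (ea w) 0 0 (eb w)"
    using ea_nonzero eb_nonzero by (intro matrix2_eqI) (simp_all add: matrix2_mult_nth)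
  also have "mpoly_const \<dots> ** mopQ w = mpoly_const ?M ** lift_geg w"
    unfolding lift_geg_eq by (simp add: mpoly_const_mult matrix_mul_assoc)
  finally show ?thesis .
qed

lemma has_eigen_liftI:
  assumes "D \<in> diffops"
    "\<And>w. D (lift_geg w) = mpoly_const (mat2 (L w $ 1 $ 1) (L w $ 1 $ 2 * ea w / eb w)
    (L w $ 2 $ 1 * eb w / ea w) (L w $ 2 $ 2)) ** lift_geg w"
  shows "has_eigen D L"
proof -
  have ll: "left_linear D" using assms by (simp add: left_linear_diffops)
  have "D (mopQ w) = mpoly_const (L w) ** mopQ w" for w
    unfolding mopQ_def left_linear_mult[OF ll] assms(2) matrix_mul_assoc mpoly_const_mult[symmetric]
    using ea_nonzero eb_nonzero
    by (intro arg_cong2[where f = "(**)"] arg_cong[where f = mpoly_const] matrix2_eqI refl)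
      (simp_all add: matrix2_mult_nth)
  then show ?thesis using assms(1) by (simp add: has_eigen_def)
qed

lemma D_diffops: "D1 p n \<in> diffops" "D2 p n \<in> diffops" "D3 p n \<in> diffops" "D4 p n \<in> diffops"
  by (simp_all add: diffops_def D1_def D2_def D3_def D4_def)

lemma has_eigen_D1: "has_eigen (D1 p n) (\<lambda>w. mat2 (ea w * (eb w + 1)) 0 0 0)"
  by (intro has_eigen_liftI D_diffops matrix2_eqI)
    (simp_all add: D1_nth drop_lift_geg matrix2_mult_nth lift_nth euler_smult pderiv_smult)

lemma has_eigen_D2: "has_eigen (D2 p n) (\<lambda>w. mat2 0 0 0 ((ea w + 1) * eb w))"
  by (intro has_eigen_liftI D_diffops matrix2_eqI)
    (simp_all add: D2_nth drop_lift_geg matrix2_mult_nth lift_nth euler_smult pderiv_smult)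

lemma has_eigen_D3: "has_eigen (D3 p n) (\<lambda>w. mat2 0 0 (ea w * (ea w + 1)) 0)"
  using ea_nonzero eb_nonzero by (intro has_eigen_liftI D_diffops matrix2_eqI)
    (simp_all add: D3_nth drop_lift_geg matrix2_mult_nth lift_nth euler_smult pderiv_smult mult_ac)

lemma has_eigen_D4: "has_eigen (D4 p n) (\<lambda>w. mat2 0 (eb w * (eb w + 1)) 0 0)"
  using ea_nonzero eb_nonzero by (intro has_eigen_liftI D_diffops matrix2_eqI)
    (simp_all add: D4_nth drop_lift_geg matrix2_mult_nth lift_nth euler_smult pderiv_smult mult_ac)

lemma has_eigen_unique:
  assumes "has_eigen D L" "has_eigen E L" shows "D = E"
  using assms unfolding has_eigen_def
  by (intro left_linear_eqI[OF mopQ_monic] left_linear_diffops) auto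

lemma has_eigen_add: "has_eigen D L \<Longrightarrow> has_eigen E M \<Longrightarrow> has_eigen (D + E) (\<lambda>w. L w + M w)"
  by (simp add: has_eigen_def diffops_add mpoly_const_add matrix2_add_mult)

text \<open>Eigenvalues multiply in the same order as the operators: Q(DE) = (LQ)E = L(QE) =
  LMQ.\<close>

lemma has_eigen_prod: "has_eigen D L \<Longrightarrow> has_eigen E M \<Longrightarrow> has_eigen (op_prod D E) (\<lambda>w. L w ** M w)"
  by (simp add: has_eigen_def diffops_comp mpoly_const_mult left_linear_mult[OF left_linear_diffops]
      matrix_mul_assoc[symmetric]) (simp add: op_prod_def left_linear_mult[OF left_linear_diffops])

lemma has_eigen_scale: "has_eigen D L \<Longrightarrow> has_eigen (op_scale c D) (\<lambda>w. map_matrix ((*) c) (L w))"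
proof -
  assume D: "has_eigen D L"
  then have "op_scale c D (mopQ w) = mpoly_const (map_matrix ((*) c) (L w)) ** mopQ w" for w
    by (intro matrix2_eqI) (simp_all add: has_eigen_def op_scale_def matrix2_mult_nth smult_add_right)
  then show ?thesis using D by (simp add: has_eigen_def diffops_scale)
qed

lemma has_eigen_id: "has_eigen id (\<lambda>w. mat 1)"
  by (simp add: has_eigen_def diffops_id)

end

section \<open>The shape of the eigenvalues\<close>

lemma poly_eq_on_nats:
  fixes f g :: "complex poly"
  assumes "\<And>w. poly f (of_nat w) = poly g (of_nat w)" shows "f = g"
proof -
  have "range of_nat \<subseteq> {x. poly (f - g) x = 0}"
    by (auto simp: assms)
  then have "infinite {x. poly (f - g) x = 0}"
    using range_inj_infinite[OF inj_of_nat] infinite_super by blast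
  then show ?thesis using poly_roots_finite[of "f - g"] by auto
qed

context gegenbauer_weight
begin

text \<open>Families of the form \<open>w \<mapsto> T(C\<^sub>w)\<close>, with \<open>T\<close> a scalar differential operator, have this
  property, because the Gegenbauer equation degenerates to a recursion for the Taylor coefficients
  at its singular point \<open>1\<close>.\<close>

definition jets_polynomial :: "(nat \<Rightarrow> complex poly) \<Rightarrow> bool" where
  "jets_polynomial f \<longleftrightarrow>
     (\<forall>k. \<exists>h. \<forall>w. poly ((pderiv ^^ k) (f w)) 1 = poly h (et w) * poly (geg w) 1)"

lemma jets_polynomial_add:
  assumes "jets_polynomial f" "jets_polynomial g" shows "jets_polynomial (\<lambda>w. f w + g w)"
  unfolding jets_polynomial_def
proof
  fix k
  obtain h h' where "\<And>w. poly ((pderiv ^^ k) (f w)) 1 = poly h (et w) * poly (geg w) 1"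
    "\<And>w. poly ((pderiv ^^ k) (g w)) 1 = poly h' (et w) * poly (geg w) 1"
    using assms unfolding jets_polynomial_def by meson
  then show "\<exists>h. \<forall>w. poly ((pderiv ^^ k) (f w + g w)) 1 = poly h (et w) * poly (geg w) 1"
    by (intro exI[of _ "h + h'"]) (simp add: higher_pderiv_add algebra_simps)
qed

lemma jets_polynomial_smult:
  assumes "jets_polynomial f" shows "jets_polynomial (\<lambda>w. smult c (f w))"
  unfolding jets_polynomial_def
proof
  fix k
  obtain h where "\<And>w. poly ((pderiv ^^ k) (f w)) 1 = poly h (et w) * poly (geg w) 1"
    using assms unfolding jets_polynomial_def by meson
  then show "\<exists>h. \<forall>w. poly ((pderiv ^^ k) (smult c (f w))) 1 = poly h (et w) * poly (geg w) 1"
    by (intro exI[of _ "smult c h"]) (simp add: higher_pderiv_smult algebra_simps)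
qed

lemma jets_polynomial_diff:
  "jets_polynomial f \<Longrightarrow> jets_polynomial g \<Longrightarrow> jets_polynomial (\<lambda>w. f w - g w)"
  using jets_polynomial_add[of f "\<lambda>w. smult (-1) (g w)"] jets_polynomial_smult[of g "-1"] by simp

lemma jets_polynomial_0: "jets_polynomial (\<lambda>w. 0)"
  by (auto simp: jets_polynomial_def intro!: exI[of _ 0])

lemma jets_polynomial_sum:
  "(\<And>i. i \<in> I \<Longrightarrow> jets_polynomial (f i)) \<Longrightarrow> jets_polynomial (\<lambda>w. \<Sum>i\<in>I. f i w)"
  by (induction I rule: infinite_finite_induct) (simp_all add: jets_polynomial_add jets_polynomial_0)

lemma jets_polynomial_pderiv:
  assumes "jets_polynomial f" shows "jets_polynomial (\<lambda>w. pderiv (f w))"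
  unfolding jets_polynomial_def
proof
  fix k show "\<exists>h. \<forall>w. poly ((pderiv ^^ k) (pderiv (f w))) 1 = poly h (et w) * poly (geg w) 1"
    using assms[unfolded jets_polynomial_def, rule_format, of "Suc k"]
    by (simp add: funpow_Suc_right del: funpow.simps)
qed

lemma jets_polynomial_higher_pderiv:
  "jets_polynomial f \<Longrightarrow> jets_polynomial (\<lambda>w. (pderiv ^^ k) (f w))"
  by (induction k) (simp_all add: jets_polynomial_pderiv)

lemma higher_pderiv_X_mult:
  "(pderiv ^^ k) (pCons 0 f) = pCons 0 ((pderiv ^^ k) f) + smult (of_nat k) ((pderiv ^^ (k - 1)) f)"
    for f :: "complex poly"
proof (induction k)
  case (Suc k)
  then show ?case
    by (cases k; intro complex_poly_ext) (simp_all add: pderiv_pCons pderiv_add pderiv_smult algebra_simps)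
qed simp

lemma jets_polynomial_X_mult:
  assumes "jets_polynomial f" shows "jets_polynomial (\<lambda>w. pCons 0 (f w))"
  unfolding jets_polynomial_def
proof
  fix k
  obtain h h' where "\<And>w. poly ((pderiv ^^ k) (f w)) 1 = poly h (et w) * poly (geg w) 1"
    "\<And>w. poly ((pderiv ^^ (k - 1)) (f w)) 1 = poly h' (et w) * poly (geg w) 1"
    using assms unfolding jets_polynomial_def by meson
  then show "\<exists>h. \<forall>w. poly ((pderiv ^^ k) (pCons 0 (f w))) 1 = poly h (et w) * poly (geg w) 1"
    by (intro exI[of _ "h + smult (of_nat k) h'"]) (simp add: higher_pderiv_X_mult algebra_simps)
qed

lemma jets_polynomial_mult:
  assumes "jets_polynomial f" shows "jets_polynomial (\<lambda>w. f w * g)"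
proof (induction g)
  case (pCons c g)
  then show ?case
    by (simp add: jets_polynomial_add jets_polynomial_smult jets_polynomial_X_mult assms)
qed (simp add: jets_polynomial_0)

lemma jets_polynomial_euler:
  "jets_polynomial f \<Longrightarrow> jets_polynomial (\<lambda>w. euler c (f w))"
  unfolding euler_def
  by (simp add: jets_polynomial_add jets_polynomial_smult jets_polynomial_X_mult jets_polynomial_pderiv)

text \<open>At x = 1 the factor x^2 - 1 kills the derivative of order k + 2, so the differentiated
  equation determines derivative k + 1 from derivative k.\<close>

lemma gegenbauer_op_higher_pderiv:
  "(pderiv ^^ k) (gegenbauer_op f) = [:-1, 0, 1:] * (pderiv ^^ (k + 2)) f
     + smult (2 * of_nat k + cn + 2) (pCons 0 ((pderiv ^^ (k + 1)) f))
     + smult (of_nat k * (of_nat k + cn + 1)) ((pderiv ^^ k) f)"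
proof (induction k)
  case 0 then show ?case by (simp add: gegenbauer_op_def numeral_2_eq_2)
next
  case (Suc k)
  show ?case
    unfolding funpow.simps(2) o_apply Suc
    by (rule complex_poly_ext, simp add: pderiv_add pderiv_diff pderiv_mult pderiv_smult pderiv_pCons, algebra)
qed

lemma jets_polynomial_geg: "jets_polynomial geg"
  unfolding jets_polynomial_def
proof
  fix k show "\<exists>h. \<forall>w. poly ((pderiv ^^ k) (geg w)) 1 = poly h (et w) * poly (geg w) 1"
  proof (induction k)
    case 0 show ?case by (intro exI[of _ 1]) simp
  next
    case (Suc k)
    then obtain h where h: "\<And>w. poly ((pderiv ^^ k) (geg w)) 1 = poly h (et w) * poly (geg w) 1" by auto
    define c where "c = 2 * of_nat k + cn + 2"
    define d where "d = of_nat k * (of_nat k + cn + 1)"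
    \<comment> \<open>The recursion at x = 1 can be solved for the next derivative because this
      factor is positive.\<close>
    have "c = of_real (2 * real k + n + 2)" by (simp add: c_def)
    then have c: "c \<noteq> 0" using n_pos by (simp only: of_real_eq_0_iff)
    have "poly ((pderiv ^^ Suc k) (geg w)) 1 = poly (smult (1 / c) ([:- d, 1:] * h)) (et w) * poly (geg w) 1" for w
    proof -
      have "poly ((pderiv ^^ k) (gegenbauer_op (geg w))) 1 = et w * poly ((pderiv ^^ k) (geg w)) 1"
        by (simp add: geg_ode higher_pderiv_smult et_def)
      then have "c * poly ((pderiv ^^ Suc k) (geg w)) 1 = (et w - d) * poly ((pderiv ^^ k) (geg w)) 1"
        unfolding gegenbauer_op_higher_pderiv c_def[symmetric] d_def[symmetric]
        by (simp add: algebra_simps)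
      then show ?thesis using c by (simp add: h field_simps)
    qed
    then show ?case by blast
  qed
qed

lemma jets_polynomial_eigenvalue:
  assumes "jets_polynomial f" "\<And>w. f w = smult (c w) (geg w)"
  obtains h where "\<And>w. c w = poly h (et w)"
proof -
  from assms(1)[unfolded jets_polynomial_def, rule_format, of 0]
  obtain h where "\<And>w. poly (f w) 1 = poly h (et w) * poly (geg w) 1" by auto
  then have "c w * poly (geg w) 1 = poly h (et w) * poly (geg w) 1" for w
    by (simp add: assms(2))
  then have "c w = poly h (et w)" for w using poly_geg_1[of w] mult_right_cancel by blast
  then show thesis by (rule that)
qed

lemma jets_polynomial_diffop_lift:
  assumes "D \<in> diffops" shows "jets_polynomial (\<lambda>w. D (lift_geg w) $ i $ j)"
proof -
  obtain Fs where D: "D = diffop Fs" using assms by (auto simp: diffops_def)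
  have "jets_polynomial (\<lambda>w. lift_geg w $ i $ l)" for i l
    using exhaust_2[of i] exhaust_2[of l]
    by (auto simp: lift_nth jets_polynomial_euler jets_polynomial_pderiv jets_polynomial_geg)
  then show ?thesis unfolding D diffop_nth
    by (intro jets_polynomial_sum jets_polynomial_add jets_polynomial_mult jets_polynomial_higher_pderiv)
qed

section \<open>Entries of the eigenvalues as polynomials in t\<close>

lemma drop_const_mult:
  "drop1 (mpoly_const A ** P) i = smult (A $ i $ 1) (drop1 P 1) + smult (A $ i $ 2) (drop1 P 2)"
  "drop2 (mpoly_const A ** P) i = smult (A $ i $ 1) (drop2 P 1) + smult (A $ i $ 2) (drop2 P 2)"
  by (simp_all add: drop1_def drop2_def matrix2_mult_nth euler_add euler_smult pderiv_add pderiv_smult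
      smult_diff_right algebra_simps)

text \<open>Following \<open>D\<close> on lifted polynomials by \<open>drop1\<close> or
  \<open>drop2\<close> gives scalar operators diagonal on the \<open>geg w\<close>; the jets at 1
  show that their eigenvalues are polynomials in t. Off the diagonal, the factor a/b from
  \<open>has_eigen_lift\<close> turns (a+1)b into a(a+1), and b/a turns a(b+1) into b(b+1).\<close>

lemma eigen_scalar_polynomials:
  assumes "has_eigen D L"
  obtains h11 h12 h21 h22 where
    "\<And>w. L w $ 1 $ 1 * (ea w * (eb w + 1)) = poly h11 (et w)"
    "\<And>w. L w $ 2 $ 2 * ((ea w + 1) * eb w) = poly h22 (et w)"
    "\<And>w. L w $ 1 $ 2 * (ea w * (ea w + 1)) = poly h12 (et w)"
    "\<And>w. L w $ 2 $ 1 * (eb w * (eb w + 1)) = poly h21 (et w)"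
proof -
  have D: "D \<in> diffops" using assms by (simp add: has_eigen_def)
  have j: "jets_polynomial (\<lambda>w. drop1 (D (lift_geg w)) i)" "jets_polynomial (\<lambda>w. drop2 (D (lift_geg w)) i)" for i
    unfolding drop1_def drop2_def
    by (intro jets_polynomial_diff jets_polynomial_euler jets_polynomial_pderiv jets_polynomial_diffop_lift D)+
  note e = has_eigen_lift[OF assms]
  have d: "drop1 (D (lift_geg w)) 1 = smult (L w $ 1 $ 1 * (ea w * (eb w + 1))) (geg w)"
    "drop2 (D (lift_geg w)) 2 = smult (L w $ 2 $ 2 * ((ea w + 1) * eb w)) (geg w)"
    "drop2 (D (lift_geg w)) 1 = smult (L w $ 1 $ 2 * (ea w * (ea w + 1))) (geg w)"
    "drop1 (D (lift_geg w)) 2 = smult (L w $ 2 $ 1 * (eb w * (eb w + 1))) (geg w)" for w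
    using ea_nonzero[of w] eb_nonzero[of w] by (simp_all add: e drop_const_mult drop_lift_geg)
  obtain h11 where h11: "\<And>w. L w $ 1 $ 1 * (ea w * (eb w + 1)) = poly h11 (et w)"
    by (rule jets_polynomial_eigenvalue[OF j(1) d(1)]) (rule that)
  obtain h22 where h22: "\<And>w. L w $ 2 $ 2 * ((ea w + 1) * eb w) = poly h22 (et w)"
    by (rule jets_polynomial_eigenvalue[OF j(2) d(2)]) (rule that)
  obtain h12 where h12: "\<And>w. L w $ 1 $ 2 * (ea w * (ea w + 1)) = poly h12 (et w)"
    by (rule jets_polynomial_eigenvalue[OF j(2) d(3)]) (rule that)
  obtain h21 where h21: "\<And>w. L w $ 2 $ 1 * (eb w * (eb w + 1)) = poly h21 (et w)"
    by (rule jets_polynomial_eigenvalue[OF j(1) d(4)]) (rule that)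
  from h11 h22 h12 h21 show thesis by (rule that)
qed

lemma ea_eb_poly: "ea w = poly [:cp, 1:] (of_nat w)" "eb w = poly [:cn - cp, 1:] (of_nat w)"
  "et w = poly [:0, cn + 1, 1:] (of_nat w)"
  by (simp_all add: ea_def eb_def et_eq algebra_simps)

text \<open>An identity at all natural w is an identity of polynomials, hence may be evaluated at
  the non-integral or negative zeros of \<open>g\<close>.\<close>

lemma eigen_root:
  assumes "\<And>w. poly f (of_nat w) * poly g (of_nat w) = poly h (et w)"
    and "poly g x = 0"
  shows "poly h (x * (x + cn + 1)) = 0"
proof -
  have "f * g = h \<circ>\<^sub>p [:0, cn + 1, 1:]"
    by (rule poly_eq_on_nats) (simp add: assms(1) poly_pcompose ea_eb_poly)
  then have "poly f x * poly g x = poly (h \<circ>\<^sub>p [:0, cn + 1, 1:]) x"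
    by (metis poly_mult)
  then show ?thesis using assms(2) by (simp add: poly_pcompose algebra_simps)
qed

text \<open>Polynomiality of the entries in w forces the scalar eigenvalues to vanish where their
  known factors do. The diagonal ones are thus divisible by t + c1 = a(b+1) and t + c2 = (a+1)b
  respectively. The off-diagonal ones are divisible by both; cancelling a(a+1) or b(b+1) from this
  product leaves the other one.\<close>

lemma eigen_entries:
  assumes "has_eigen D L"
  obtains h11 h12 h21 h22 where
    "\<And>w. L w = mat2 (poly h11 (et w)) (eb w * (eb w + 1) * poly h12 (et w))
      (ea w * (ea w + 1) * poly h21 (et w)) (poly h22 (et w))"
proof -
  obtain l where l: "\<And>w i j. L w $ i $ j = poly (l i j) (of_nat w)"
  proof -
    have "\<exists>h. \<forall>w. L w $ i $ j = poly h (of_nat w)" for i j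
      using eigen_polynomial[OF mopQ_monic, of D L i j] assms unfolding has_eigen_def by blast
    then show thesis using that by metis
  qed
  obtain h11 h12 h21 h22 where h: 
    "\<And>w. L w $ 1 $ 1 * (ea w * (eb w + 1)) = poly h11 (et w)"
    "\<And>w. L w $ 2 $ 2 * ((ea w + 1) * eb w) = poly h22 (et w)"
    "\<And>w. L w $ 1 $ 2 * (ea w * (ea w + 1)) = poly h12 (et w)"
    "\<And>w. L w $ 2 $ 1 * (eb w * (eb w + 1)) = poly h21 (et w)"
    by (rule eigen_scalar_polynomials[OF assms]) (rule that)
  define c1 c2 where "c1 = cp * (cn - cp + 1)" and "c2 = (cp + 1) * (cn - cp)"
  have "c2 - c1 = of_real (n - 2 * p)" by (simp add: c1_def c2_def algebra_simps)
  moreover have "n - 2 * p \<noteq> 0" using p_less by simp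
  ultimately have c12: "c1 \<noteq> c2" by (metis eq_iff_diff_eq_0 of_real_eq_0_iff)
  have root: "poly h (x * (x + cn + 1)) = 0"
    if "\<And>w. L w $ i $ j * poly g (of_nat w) = poly h (et w)" "poly g x = 0" for i j h g x
    using that by (intro eigen_root[of "l i j" g]) (simp_all add: l)
  let ?a = "[:cp, 1:]" and ?b = "[:cn - cp, 1:]"
  have g: "poly (?a * (?b + 1)) (of_nat w) = ea w * (eb w + 1)"
    "poly ((?a + 1) * ?b) (of_nat w) = (ea w + 1) * eb w"
    "poly (?a * (?a + 1)) (of_nat w) = ea w * (ea w + 1)"
    "poly (?b * (?b + 1)) (of_nat w) = eb w * (eb w + 1)" for w
    by (simp add: ea_eb_poly, algebra)+
  note roots = root[OF h(1)[folded g(1)]] root[OF h(2)[folded g(2)]]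
    root[OF h(3)[folded g(3)]] root[OF h(4)[folded g(4)]]
  \<comment> \<open>The values of t at the zeros w of a, a + 1, b and b + 1, in this order.\<close>
  have x: "- cp * (- cp + cn + 1) = - c1" "(- cp - 1) * ((- cp - 1) + cn + 1) = - c2"
    "(cp - cn) * (cp - cn + cn + 1) = - c2" "(cp - cn - 1) * (cp - cn - 1 + cn + 1) = - c1"
    by (simp_all add: c1_def c2_def algebra_simps)
  have r: "poly h11 (-c1) = 0" "poly h22 (-c2) = 0" "poly h12 (-c1) = 0" "poly h12 (-c2) = 0"
    "poly h21 (-c1) = 0" "poly h21 (-c2) = 0"
    using roots(1)[of "- cp"] roots(2)[of "- cp - 1"] roots(3)[of "- cp"] roots(3)[of "- cp - 1"]
      roots(4)[of "cp - cn"] roots(4)[of "cp - cn - 1"] unfolding x by simp_all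
  have linear_factor: "\<exists>q. h = [:c, 1:] * q" if "poly h (- c) = 0" for h :: "complex poly" and c
    using that poly_eq_0_iff_dvd[of h "- c"] by (simp only: dvd_def minus_minus)
  have two_roots: "\<exists>q. h = [:c1, 1:] * ([:c2, 1:] * q)" if h: "poly h (-c1) = 0" "poly h (-c2) = 0" for h
  proof -
    obtain q where q: "h = [:c1, 1:] * q" using linear_factor[OF h(1)] by blast
    then have "poly q (-c2) = 0" using h c12 by simp
    then show ?thesis using q linear_factor by blast
  qed
  obtain q11 q22 where q11: "h11 = [:c1, 1:] * q11" and q22: "h22 = [:c2, 1:] * q22"
    using linear_factor r(1,2) by blast
  obtain q12 q21 where q12: "h12 = [:c1, 1:] * ([:c2, 1:] * q12)" and q21: "h21 = [:c1, 1:] * ([:c2, 1:] * q21)"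
    using two_roots[OF r(3,4)] two_roots[OF r(5,6)] by blast
  have t: "c1 + et w = ea w * (eb w + 1)" "c2 + et w = (ea w + 1) * eb w" for w
    using et_plus[of w] by (simp_all add: c1_def c2_def add.commute)
  have lin: "poly ([:c, 1:] * q) x = (c + x) * poly q x" for c x and q :: "complex poly"
    by (simp add: algebra_simps)
  have "L w = mat2 (poly q11 (et w)) (eb w * (eb w + 1) * poly q12 (et w))
      (ea w * (ea w + 1) * poly q21 (et w)) (poly q22 (et w))" for w
  proof -
    have "L w $ 1 $ 1 * (ea w * (eb w + 1)) = poly q11 (et w) * (ea w * (eb w + 1))"
      "L w $ 2 $ 2 * ((ea w + 1) * eb w) = poly q22 (et w) * ((ea w + 1) * eb w)"
      "L w $ 1 $ 2 * (ea w * (ea w + 1)) = (eb w * (eb w + 1) * poly q12 (et w)) * (ea w * (ea w + 1))"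
      "L w $ 2 $ 1 * (eb w * (eb w + 1)) = (ea w * (ea w + 1) * poly q21 (et w)) * (eb w * (eb w + 1))"
      unfolding h q11 q12 q21 q22 lin t by (simp_all only: mult_ac)
    then show ?thesis
      using ea_nonzero[of w] eb_nonzero[of w] by (intro matrix2_eqI) simp_all
  qed
  then show thesis by (rule that)
qed

end

section \<open>Generators\<close>

lemma subalgebra_generated: "subalgebra (generated_algebra S)"
  unfolding generated_algebra_def by (rule hull_in) (auto simp: subalgebra_def)

lemma generated_subset: "S \<subseteq> generated_algebra S"
  unfolding generated_algebra_def by (rule hull_subset)

lemma generated_minimal: "S \<subseteq> A \<Longrightarrow> subalgebra A \<Longrightarrow> generated_algebra S \<subseteq> A"
  unfolding generated_algebra_def by (rule hull_minimal)

section \<open>Rigidity of constant diagonal eigenvalues\<close>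

context gegenbauer_weight
begin

text \<open>Taylor coefficients at 0 of a pair (f, g) with R_1 f = R_2 g, that is g' = xf' + pf and
  f' = xg' + (n-p)g, started at f(0) = 1, g(0) = 0.\<close>

definition kernel_coeffs :: "nat \<Rightarrow> complex \<times> complex" where
  "kernel_coeffs = rec_nat (1, 0) (\<lambda>k (x, y).
     ((of_nat k + (cn - cp)) * y / of_nat (Suc k), (of_nat k + cp) * x / of_nat (Suc k)))"

lemma kernel_coeffs_Suc:
  "of_nat (Suc k) * fst (kernel_coeffs (Suc k)) = (of_nat k + (cn - cp)) * snd (kernel_coeffs k)"
  "of_nat (Suc k) * snd (kernel_coeffs (Suc k)) = (of_nat k + cp) * fst (kernel_coeffs k)"
  by (simp_all add: kernel_coeffs_def split: prod.split del: of_nat_Suc)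

lemma lift_add: "lift (f + g) (f' + g') = lift f f' + lift g g'"
  by (intro matrix2_eqI) (simp_all add: lift_nth euler_add pderiv_add)

lemma lift_smult: "lift (smult c f) (smult c g) = mpoly_const (mat2 c 0 0 c) ** lift f g"
  by (intro matrix2_eqI) (simp_all add: lift_nth matrix2_mult_nth euler_smult pderiv_smult)

text \<open>Every \<open>f\<close> is a scalar combination of the \<open>geg w\<close>, and the
  eigenvalue does not depend on w and commutes with scalars.\<close>

lemma has_eigen_const_lift:
  assumes "has_eigen D (\<lambda>w. mat2 c 0 0 d)"
  shows "D (lift f f) = mpoly_const (mat2 c 0 0 d) ** lift f f"
proof -
  have ll: "left_linear D" using assms by (simp add: has_eigen_def left_linear_diffops)
  have "D (lift f f) = mpoly_const (mat2 c 0 0 d) ** lift f f" if "\<And>k. k \<ge> w \<Longrightarrow> coeff f k = 0" for w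
    using that
  proof (induction w arbitrary: f)
    case 0
    then have "f = 0" by (intro poly_eqI) simp
    moreover have "lift 0 0 = 0" by (intro matrix2_eqI) (simp_all add: lift_nth)
    ultimately show ?case by (simp add: left_linear_0[OF ll])
  next
    case (Suc w)
    define g where "g = f - smult (coeff f w) (geg w)"
    have "coeff g k = 0" if "k \<ge> w" for k
      using that Suc.prems[of k] by (cases "k = w") (simp_all add: g_def coeff_geg_top coeff_geg_eq_0)
    then have "D (lift g g) = mpoly_const (mat2 c 0 0 d) ** lift g g" by (rule Suc.IH)
    moreover have "D (lift_geg w) = mpoly_const (mat2 c 0 0 d) ** lift_geg w"
      using has_eigen_lift[OF assms, of w] by simp
    moreover have "f = smult (coeff f w) (geg w) + g" by (simp add: g_def)
    then have "lift f f = mpoly_const (mat2 (coeff f w) 0 0 (coeff f w)) ** lift_geg w + lift g g"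
      using lift_add lift_smult by metis
    moreover have "mat2 c 0 0 d ** mat2 x 0 0 x = mat2 x 0 0 x ** mat2 c 0 0 d" for x
      by (intro matrix2_eqI) (simp_all add: matrix2_mult_nth)
    ultimately show ?case
      by (simp add: left_linear_add[OF ll] left_linear_mult[OF ll] matrix_add_ldistrib matrix_mul_assoc
          mpoly_const_mult[symmetric])
  qed
  from this[of "Suc (degree f)"] show ?thesis by (simp add: coeff_eq_0)
qed

lemma diffop_coeff_0:
  assumes "\<And>j k. k < length Fs \<Longrightarrow> coeff (P $ i $ j) k = 0"
  shows "coeff (diffop Fs P $ i $ j) 0 = 0"
  by (simp add: diffop_nth coeff_sum coeff_mult coeff_higher_pderiv assms)

text \<open>The equation $R_1f = R_2g$ has a power series solution.  An operator acting as $c$ on the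
  image of $R_1$ and as $d$ on that of $R_2$ acts, having finite order, as both on a sufficiently
  long truncation of it.\<close>

lemma has_eigen_const_eq:
  assumes "has_eigen D (\<lambda>w. mat2 c 0 0 d)"
  shows "c = d"
proof -
  obtain Fs where D: "D = diffop Fs" using assms by (auto simp: has_eigen_def diffops_def)
  have ll: "left_linear D" by (simp add: D left_linear_diffop)
  \<comment> \<open>A truncation at degree \<open>m\<close> satisfies the equation only in
    coefficients below \<open>m\<close>, since derivatives shift the index by one; this covers all
    coefficients below the length of \<open>Fs\<close>.\<close>
  define m where "m = Suc (length Fs)"
  define f where "f = (\<Sum>k\<le>m. monom (fst (kernel_coeffs k)) k)"
  define g where "g = (\<Sum>k\<le>m. monom (snd (kernel_coeffs k)) k)"
  have cf: "coeff f k = fst (kernel_coeffs k)" "coeff g k = snd (kernel_coeffs k)" if "k \<le> m" for k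
    using that by (auto simp: f_def g_def coeff_sum)
  \<comment> \<open>\<open>E1\<close> keeps the first row and \<open>E2\<close> moves the second row
    into first place, so the first row of \<open>P\<close> is R_1 f - R_2 g.\<close>
  define E1 E2 where "E1 = mpoly_const (mat2 1 0 0 0)" and "E2 = mpoly_const (mat2 0 1 0 0)"
  define P where "P = E1 ** lift f f - E2 ** lift g g"
  have P: "coeff (P $ 1 $ 1) k = 0" "coeff (P $ 1 $ 2) k = 0" if "k < m" for k
    using that kernel_coeffs_Suc[of k]
    by (simp_all add: P_def E1_def E2_def matrix2_mult_nth lift_nth coeff_pderiv cf del: of_nat_Suc)
  have "D P = E1 ** (mpoly_const (mat2 c 0 0 d) ** lift f f) - E2 ** (mpoly_const (mat2 c 0 0 d) ** lift g g)"
    unfolding P_def E1_def E2_def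
    by (simp add: left_linear_diff[OF ll] left_linear_mult[OF ll] has_eigen_const_lift[OF assms])
  then have "coeff (D P $ 1 $ 1) 0 = c * coeff (lift f f $ 1 $ 1) 0 - d * coeff (lift g g $ 2 $ 1) 0"
    by (simp add: E1_def E2_def matrix2_mult_nth)
  moreover have "coeff (D P $ 1 $ 1) 0 = 0"
    unfolding D
  proof (rule diffop_coeff_0)
    fix j :: 2 and k assume "k < length Fs"
    then show "coeff (P $ 1 $ j) k = 0" using P[of k] exhaust_2[of j] by (auto simp: m_def)
  qed
  moreover have "coeff (P $ 1 $ 1) 0 = 0" by (rule P) (simp add: m_def)
  then have "coeff (lift f f $ 1 $ 1) 0 = coeff (lift g g $ 2 $ 1) 0"
    by (simp add: P_def E1_def E2_def matrix2_mult_nth)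
  moreover have "coeff (lift f f $ 1 $ 1) 0 = cp"
    by (simp add: lift_nth cf kernel_coeffs_def)
  ultimately have "(c - d) * cp = 0" unfolding left_diff_distrib by metis
  then show ?thesis using p_pos by simp
qed

section \<open>The algebra generated by D_1 + D_2 and D_3 + D_4\<close>

abbreviation "Gen \<equiv> generated_algebra {D1 p n + D2 p n, D3 p n + D4 p n}"

text \<open>Replaces computation with operators by computation with 2x2 matrix functions of w;
  \<open>has_eigen_unique\<close> allows the return to operators.\<close>

definition gen_eigen :: "(nat \<Rightarrow> cmat) \<Rightarrow> bool" where
  "gen_eigen L \<longleftrightarrow> (\<exists>D\<in>Gen. has_eigen D L)"

lemma subalgebra_Gen:
  "id \<in> Gen" "D \<in> Gen \<Longrightarrow> E \<in> Gen \<Longrightarrow> D + E \<in> Gen"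
  "D \<in> Gen \<Longrightarrow> E \<in> Gen \<Longrightarrow> op_prod D E \<in> Gen" "D \<in> Gen \<Longrightarrow> op_scale c D \<in> Gen"
  using subalgebra_generated[of "{D1 p n + D2 p n, D3 p n + D4 p n}"]
  by (simp_all add: subalgebra_def)

lemma gen_eigen_add: "gen_eigen L \<Longrightarrow> gen_eigen M \<Longrightarrow> gen_eigen (\<lambda>w. L w + M w)"
  unfolding gen_eigen_def using subalgebra_Gen(2) has_eigen_add by blast

lemma gen_eigen_mult: "gen_eigen L \<Longrightarrow> gen_eigen M \<Longrightarrow> gen_eigen (\<lambda>w. L w ** M w)"
  unfolding gen_eigen_def using subalgebra_Gen(3) has_eigen_prod by blast

lemma gen_eigen_scale: "gen_eigen L \<Longrightarrow> gen_eigen (\<lambda>w. map_matrix ((*) c) (L w))"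
  unfolding gen_eigen_def using subalgebra_Gen(4) has_eigen_scale by blast

lemma gen_eigen_id: "gen_eigen (\<lambda>w. mat 1)"
  unfolding gen_eigen_def using subalgebra_Gen(1) has_eigen_id by blast

lemma gen_eigen_diff:
  assumes "gen_eigen L" "gen_eigen M" shows "gen_eigen (\<lambda>w. L w - M w)"
proof -
  have "L w + map_matrix ((*) (-1)) (M w) = L w - M w" for w
    by (intro matrix2_eqI) simp_all
  then show ?thesis using gen_eigen_add[OF assms(1) gen_eigen_scale[OF assms(2), of "-1"]] by simp
qed

lemma gen_eigen_cong: "gen_eigen L \<Longrightarrow> (\<And>w. L w = M w) \<Longrightarrow> gen_eigen M"
  by (metis ext)

lemma gen_eigen_D:
  "gen_eigen (\<lambda>w. mat2 (ea w * (eb w + 1)) 0 0 0)"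
  "gen_eigen (\<lambda>w. mat2 0 0 0 ((ea w + 1) * eb w))"
  "gen_eigen (\<lambda>w. mat2 0 0 (ea w * (ea w + 1)) 0)"
  "gen_eigen (\<lambda>w. mat2 0 (eb w * (eb w + 1)) 0 0)"
proof -
  define k where "k = cn - 2 * cp"
  have "k = of_real (n - 2 * p)" by (simp add: k_def)
  then have k: "k \<noteq> 0" using p_less by (simp only: of_real_eq_0_iff)
  have eb: "eb w = ea w + k" for w by (simp add: ea_def eb_def k_def)
  let ?A = "\<lambda>w. mat2 (ea w * (eb w + 1)) 0 0 ((ea w + 1) * eb w)"
  let ?B = "\<lambda>w. mat2 0 (eb w * (eb w + 1)) (ea w * (ea w + 1)) 0"
  have "has_eigen (D1 p n + D2 p n) (\<lambda>w. mat2 (ea w * (eb w + 1)) 0 0 0 + mat2 0 0 0 ((ea w + 1) * eb w))"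
    "has_eigen (D3 p n + D4 p n) (\<lambda>w. mat2 0 0 (ea w * (ea w + 1)) 0 + mat2 0 (eb w * (eb w + 1)) 0 0)"
    by (intro has_eigen_add has_eigen_D1 has_eigen_D2 has_eigen_D3 has_eigen_D4)+
  then have "gen_eigen (\<lambda>w. mat2 (ea w * (eb w + 1)) 0 0 0 + mat2 0 0 0 ((ea w + 1) * eb w))"
    "gen_eigen (\<lambda>w. mat2 0 0 (ea w * (ea w + 1)) 0 + mat2 0 (eb w * (eb w + 1)) 0 0)"
    using generated_subset[of "{D1 p n + D2 p n, D3 p n + D4 p n}"] unfolding gen_eigen_def by auto
  note AB = this
  have A: "gen_eigen ?A" by (rule gen_eigen_cong[OF AB(1)]) (intro matrix2_eqI; simp)
  have B: "gen_eigen ?B" by (rule gen_eigen_cong[OF AB(2)]) (intro matrix2_eqI; simp)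
  \<comment> \<open>With b = a + k the difference Y^2 - X^2 has eigenvalue diag(k a(b+1), -k(a+1)b),
    so adding kX doubles the first entry and cancels the second.\<close>
  have "gen_eigen (\<lambda>w. map_matrix ((*) (1 / (2 * k))) (map_matrix ((*) k) (?A w) - ?A w ** ?A w + ?B w ** ?B w))"
    by (intro gen_eigen_scale gen_eigen_add gen_eigen_diff gen_eigen_mult A B)
  then show 1: "gen_eigen (\<lambda>w. mat2 (ea w * (eb w + 1)) 0 0 0)"
    by (rule gen_eigen_cong) (use k in \<open>intro matrix2_eqI; simp add: matrix2_mult_nth eb field_simps\<close>)
  show 2: "gen_eigen (\<lambda>w. mat2 0 0 0 ((ea w + 1) * eb w))"
    by (rule gen_eigen_cong[OF gen_eigen_diff[OF A 1]]) (intro matrix2_eqI; simp)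
  have "gen_eigen (\<lambda>w. map_matrix ((*) (1 / k)) (?B w ** mat2 0 0 0 ((ea w + 1) * eb w) - mat2 (ea w * (eb w + 1)) 0 0 0 ** ?B w))"
    by (intro gen_eigen_scale gen_eigen_diff gen_eigen_mult 1 2 B)
  then show 4: "gen_eigen (\<lambda>w. mat2 0 (eb w * (eb w + 1)) 0 0)"
    by (rule gen_eigen_cong) (use k in \<open>intro matrix2_eqI; simp add: matrix2_mult_nth eb field_simps\<close>)
  show "gen_eigen (\<lambda>w. mat2 0 0 (ea w * (ea w + 1)) 0)"
    by (rule gen_eigen_cong[OF gen_eigen_diff[OF B 4]]) (intro matrix2_eqI; simp)
qed

text \<open>Horner's scheme, with right multiplication by \<open>N\<close> in the role of
  multiplication by t.\<close>

lemma gen_eigen_poly_mult: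
  assumes L: "gen_eigen L" and N: "gen_eigen N"
    and LN: "\<And>w. L w ** N w = map_matrix ((*) (et w)) (L w)"
  shows "gen_eigen (\<lambda>w. map_matrix ((*) (poly q (et w))) (L w))"
proof (induction q)
  case 0
  show ?case by (rule gen_eigen_cong[OF gen_eigen_scale[OF L, of 0]]) (intro matrix2_eqI; simp)
next
  case (pCons c q)
  have "gen_eigen (\<lambda>w. map_matrix ((*) c) (L w) + map_matrix ((*) (poly q (et w))) (L w) ** N w)"
    by (intro gen_eigen_add gen_eigen_mult gen_eigen_scale L N pCons.IH)
  then show ?case
  proof (rule gen_eigen_cong)
    fix w
    have "map_matrix ((*) (poly q (et w))) (L w) ** N w = map_matrix ((*) (poly q (et w))) (L w ** N w)"
      by (intro matrix2_eqI) (simp_all add: matrix2_mult_nth algebra_simps)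
    then show "map_matrix ((*) c) (L w) + map_matrix ((*) (poly q (et w))) (L w) ** N w =
      map_matrix ((*) (poly (pCons c q) (et w))) (L w)"
      unfolding LN by (intro matrix2_eqI) (simp_all add: algebra_simps)
  qed
qed

lemma gen_eigen_poly_D:
  "gen_eigen (\<lambda>w. map_matrix ((*) (poly q (et w))) (mat2 (ea w * (eb w + 1)) 0 0 0))" (is ?g1)
  "gen_eigen (\<lambda>w. map_matrix ((*) (poly q (et w))) (mat2 0 0 0 ((ea w + 1) * eb w)))" (is ?g2)
  "gen_eigen (\<lambda>w. map_matrix ((*) (poly q (et w))) (mat2 0 0 (ea w * (ea w + 1)) 0))" (is ?g3)
  "gen_eigen (\<lambda>w. map_matrix ((*) (poly q (et w))) (mat2 0 (eb w * (eb w + 1)) 0 0))" (is ?g4)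
proof -
  \<comment> \<open>By \<open>et_plus\<close>, D_1 and D_2 shifted by constants have eigenvalue t in
    the first and in the second diagonal place. D_1, D_3 live in the first column and D_2, D_4 in
    the second.\<close>
  have N1: "gen_eigen (\<lambda>w. mat2 (ea w * (eb w + 1)) 0 0 0 - map_matrix ((*) (cp * (cn - cp + 1))) (mat 1))"
    and N2: "gen_eigen (\<lambda>w. mat2 0 0 0 ((ea w + 1) * eb w) - map_matrix ((*) ((cp + 1) * (cn - cp))) (mat 1))"
    by (intro gen_eigen_diff gen_eigen_D gen_eigen_scale gen_eigen_id)+
  show ?g1 ?g3
    by (rule gen_eigen_poly_mult[OF _ N1];
      intro gen_eigen_D matrix2_eqI; simp add: matrix2_mult_nth mat_def et_plus(1)[symmetric])+
  show ?g2 ?g4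
    by (rule gen_eigen_poly_mult[OF _ N2];
      intro gen_eigen_D matrix2_eqI; simp add: matrix2_mult_nth mat_def et_plus(2)[symmetric])+
qed

text \<open>Division of the diagonal entries by t + c1 and t + c2 leaves constants c and d;
  everything else is a combination of q(t) times the eigenvalues of D_1, ..., D_4. As c = d, the
  remainder is a multiple of the identity.\<close>

lemma has_eigen_generated:
  assumes D: "has_eigen D L" shows "D \<in> Gen"
proof -
  obtain h11 h12 h21 h22 where L:
    "\<And>w. L w = mat2 (poly h11 (et w)) (eb w * (eb w + 1) * poly h12 (et w))
      (ea w * (ea w + 1) * poly h21 (et w)) (poly h22 (et w))"
    by (rule eigen_entries[OF D]) (rule that)
  define c1 c2 where "c1 = cp * (cn - cp + 1)" and "c2 = (cp + 1) * (cn - cp)"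
  have rem: "\<exists>q. \<forall>t. poly h t = poly h (- c) + (t + c) * poly q t" for h :: "complex poly" and c
  proof -
    have "poly (h - [:poly h (- c):]) (- c) = 0" by simp
    then obtain q where "h - [:poly h (- c):] = [:- (- c), 1:] * q"
      unfolding poly_eq_0_iff_dvd by (rule dvdE)
    note q = this
    have "poly h t = poly h (- c) + (t + c) * poly q t" for t
      using arg_cong[OF q, of "\<lambda>f. poly f t"] by (simp add: algebra_simps)
    then show ?thesis by blast
  qed
  obtain q1 q2 where q: "\<And>t. poly h11 t = poly h11 (- c1) + (t + c1) * poly q1 t"
    "\<And>t. poly h22 t = poly h22 (- c2) + (t + c2) * poly q2 t"
    using rem[of h11 c1] rem[of h22 c2] by blast
  define c d where "c = poly h11 (- c1)" and "d = poly h22 (- c2)"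
  define M where "M w = map_matrix ((*) (poly q1 (et w))) (mat2 (ea w * (eb w + 1)) 0 0 0)
    + map_matrix ((*) (poly q2 (et w))) (mat2 0 0 0 ((ea w + 1) * eb w))
    + map_matrix ((*) (poly h21 (et w))) (mat2 0 0 (ea w * (ea w + 1)) 0)
    + map_matrix ((*) (poly h12 (et w))) (mat2 0 (eb w * (eb w + 1)) 0 0)" for w
  have LM: "L w = M w + mat2 c 0 0 d" for w
    using q[of "et w"] et_plus[of w] unfolding L M_def
    by (intro matrix2_eqI) (simp_all add: c_def d_def c1_def c2_def mult_ac)
  have M: "gen_eigen M"
    unfolding M_def by (intro gen_eigen_add gen_eigen_poly_D)
  then obtain E where "has_eigen E M" by (auto simp: gen_eigen_def)
  then have "has_eigen (D + op_scale (-1) E) (\<lambda>w. L w + map_matrix ((*) (-1)) (M w))"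
    by (intro has_eigen_add has_eigen_scale D)
  moreover have "L w + map_matrix ((*) (-1)) (M w) = mat2 c 0 0 d" for w
    unfolding LM by (intro matrix2_eqI) simp_all
  ultimately have "c = d" by (intro has_eigen_const_eq) simp
  have "gen_eigen (\<lambda>w. M w + map_matrix ((*) c) (mat 1))"
    by (intro gen_eigen_add M gen_eigen_scale gen_eigen_id)
  then have "gen_eigen L"
    by (rule gen_eigen_cong) (intro matrix2_eqI; simp add: LM \<open>c = d\<close> mat_def)
  then show ?thesis using has_eigen_unique[OF D] unfolding gen_eigen_def by blast
qed

lemma generated_has_eigen: "D \<in> Gen \<Longrightarrow> \<exists>L. has_eigen D L"
proof -
  have "subalgebra {D. \<exists>L. has_eigen D L}"
    unfolding subalgebra_def
    using has_eigen_id has_eigen_add has_eigen_prod has_eigen_scale by blast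
  moreover have "{D1 p n + D2 p n, D3 p n + D4 p n} \<subseteq> {D. \<exists>L. has_eigen D L}"
    using has_eigen_add[OF has_eigen_D1 has_eigen_D2] has_eigen_add[OF has_eigen_D3 has_eigen_D4] by blast
  ultimately have "Gen \<subseteq> {D. \<exists>L. has_eigen D L}" by (intro generated_minimal)
  then show "D \<in> Gen \<Longrightarrow> \<exists>L. has_eigen D L" by blast
qed

end

section \<open>Orthogonality\<close>

text \<open>The conjugate transpose taken on coefficients, which agrees with the pointwise one at
  real x; it keeps the integrands polynomial up to the scalar weight.\<close>

definition star :: "mpoly \<Rightarrow> mpoly" where
  "star Q = transpose (map_matrix (map_poly cnj) Q)"

lemma star_nth: "star Q $ i $ j = map_poly cnj (Q $ j $ i)"
  by (simp add: star_def transpose_def)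

lemma star_const_mult: "star (mpoly_const A ** Q) = star Q ** mpoly_const (conj_transpose A)"
proof -
  have "map_poly cnj (smult c f + smult d g) = smult (cnj c) (map_poly cnj f) + smult (cnj d) (map_poly cnj g)" for c d f g
    by (rule poly_eqI) (simp add: coeff_map_poly)
  then show ?thesis
    by (intro matrix2_eqI) (simp_all add: star_nth matrix2_mult_nth conj_transpose_def transpose_def)
qed

lemma mpoly_eval_mult: "mpoly_eval (P ** Q) x = mpoly_eval P x ** mpoly_eval Q x"
  by (intro matrix2_eqI) (simp_all add: mpoly_eval_def matrix2_mult_nth)

lemma mpoly_eval_star: "mpoly_eval (star Q) x = conj_transpose (mpoly_eval Q x)"
proof -
  have "poly (map_poly cnj f) (of_real x) = cnj (poly f (of_real x))" for f
    using poly_cnj[of f "of_real x"] by simp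
  then show ?thesis
    by (intro matrix2_eqI) (simp_all add: mpoly_eval_def star_nth conj_transpose_def transpose_def)
qed

lemma matrix_mult_scaleR:
  fixes A B :: cmat
  shows "A ** (c *\<^sub>R B) = c *\<^sub>R (A ** B)" "(c *\<^sub>R A) ** B = c *\<^sub>R (A ** B)"
  by (intro matrix2_eqI; simp add: matrix2_mult_nth scaleR_add_right)+

lemma continuous_on_poly_of_real: "continuous_on S (\<lambda>x. poly f (complex_of_real x))"
  by (intro continuous_intros)

section \<open>The scalar weight, its moments and integration by parts\<close>

context gegenbauer_weight
begin

definition wt :: "real \<Rightarrow> real" where
  "wt x = (1 - x\<^sup>2) powr (n / 2 - 1)"

definition Wpoly :: mpoly where
  "Wpoly = mat2 [:cn - cp, 0, cp:] [:0, - cn:] [:0, - cn:] [:cp, 0, cn - cp:]"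

lemma W_eq: "W p n x = wt x *\<^sub>R mpoly_eval Wpoly x"
  by (intro matrix2_eqI) (simp_all add: W_def wt_def Wpoly_def mpoly_eval_def power2_eq_square algebra_simps)

lemma one_minus_sq: "x \<in> {-1..1} \<Longrightarrow> 0 \<le> 1 - x\<^sup>2" "x \<in> {-1<..<1} \<Longrightarrow> 0 < 1 - x\<^sup>2" for x :: real
  using abs_square_le_1[of x] abs_square_less_1[of x] by auto

lemma wt_mult: assumes "x \<in> {-1..1}" shows "wt x * (1 - x\<^sup>2) = (1 - x\<^sup>2) powr (n / 2)"
proof (cases "1 - x\<^sup>2 = 0")
  case False
  then have "0 < 1 - x\<^sup>2" using one_minus_sq(1)[OF assms] by linarith
  then have "(1 - x\<^sup>2) powr (n / 2) = (1 - x\<^sup>2) powr (n / 2 - 1) * (1 - x\<^sup>2) powr 1"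
    by (simp only: powr_add[symmetric]) simp
  then show ?thesis using \<open>0 < 1 - x\<^sup>2\<close> by (simp add: wt_def)
qed simp

lemma continuous_on_wt1: "continuous_on {-1..1} (\<lambda>x. (1 - x\<^sup>2) powr (n / 2))"
  using n_pos one_minus_sq by (intro continuous_on_powr' continuous_intros) auto

definition pearson :: "complex poly \<Rightarrow> complex poly" where
  "pearson f = [:1, 0, -1:] * pderiv f - smult cn ([:0, 1:] * f)"

text \<open>This is the Pearson equation $((1-x^2)\,w\,f)' = w\,((1-x^2)f' - nxf)$ for the scalar weight
  $w = (1-x^2)^{n/2-1}$.\<close>

lemma pearson_has_integral:
  "((\<lambda>x. wt x *\<^sub>R poly (pearson f) (of_real x)) has_integral 0) {-1..1}"
proof -
  define F where "F x = (1 - x\<^sup>2) powr (n / 2) *\<^sub>R poly f (of_real x)" for x :: real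
  have "((\<lambda>x. wt x *\<^sub>R poly (pearson f) (of_real x)) has_integral (F 1 - F (-1))) {-1..1}"
  \<comment> \<open>For n < 2 the weight is unbounded near the endpoints, whereas \<open>F\<close>
    is continuous up to them and vanishes there; so derivatives are taken in the interior
    only.\<close>
  proof (rule fundamental_theorem_of_calculus_interior)
    show "continuous_on {-1..1} F"
      unfolding F_def by (intro continuous_on_scaleR continuous_on_wt1 continuous_on_poly_of_real)
    fix x :: real assume x: "x \<in> {-1<..<1}"
    have "((\<lambda>x. (1 - x\<^sup>2) powr (n / 2)) has_real_derivative n / 2 * (1 - x\<^sup>2) powr (n / 2 - 1) * (- 2 * x)) (at x)"
      using one_minus_sq(2)[OF x] by (intro DERIV_chain2[OF has_real_derivative_powr]) (auto intro!: derivative_eq_intros)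
    moreover have "((\<lambda>x. poly f (complex_of_real x)) has_vector_derivative poly (pderiv f) (of_real x)) (at x)"
      by (intro has_vector_derivative_real_field poly_DERIV)
    ultimately have "(F has_vector_derivative (1 - x\<^sup>2) powr (n / 2) *\<^sub>R poly (pderiv f) (of_real x)
      + (n / 2 * (1 - x\<^sup>2) powr (n / 2 - 1) * (- 2 * x)) *\<^sub>R poly f (of_real x)) (at x)"
      unfolding F_def by (rule has_vector_derivative_scaleR)
    also have "(1 - x\<^sup>2) powr (n / 2) *\<^sub>R poly (pderiv f) (of_real x)
      + (n / 2 * (1 - x\<^sup>2) powr (n / 2 - 1) * (- 2 * x)) *\<^sub>R poly f (of_real x) = wt x *\<^sub>R poly (pearson f) (of_real x)"
      using x wt_mult[of x, symmetric] unfolding wt_def[symmetric]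
      by (simp add: pearson_def scaleR_conv_of_real) (simp add: power2_eq_square algebra_simps)
    finally show "(F has_vector_derivative wt x *\<^sub>R poly (pearson f) (of_real x)) (at x)" .
  qed simp
  then show ?thesis by (simp add: F_def)
qed

lemma wt_measurable: "wt \<in> borel_measurable borel"
  unfolding wt_def by measurable

text \<open>For f = x the Pearson expression is (n+1)(1-x^2) - n, so the weight is a combination of
  a continuous function and an integrable derivative. Nonnegativity then gives absolute
  integrability.\<close>

lemma wt_set_integrable: "set_integrable lborel {-1..1} wt"
proof -
  have "((\<lambda>x. wt x *\<^sub>R poly (pearson [:0, 1:]) (of_real x)) has_integral 0) {-1..1}"
    by (rule pearson_has_integral)
  from has_integral_integrable[OF has_integral_Re[OF this]]
  have "(\<lambda>x. (1 / n) *\<^sub>R ((n + 1) *\<^sub>R (1 - x\<^sup>2) powr (n / 2)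
      - Re (wt x *\<^sub>R poly (pearson [:0, 1:]) (of_real x)))) integrable_on {-1..1}"
    by (intro integrable_cmul[OF integrable_diff[OF integrable_cmul[OF integrable_continuous_interval[OF continuous_on_wt1]]]])
  then have "wt integrable_on {-1..1}"
  proof (rule integrable_eq)
    fix x :: real assume x: "x \<in> {-1..1}"
    show "(1 / n) *\<^sub>R ((n + 1) *\<^sub>R (1 - x\<^sup>2) powr (n / 2)
      - Re (wt x *\<^sub>R poly (pearson [:0, 1:]) (of_real x))) = wt x"
      using n_pos unfolding wt_mult[OF x, symmetric]
      by (simp add: pearson_def pderiv_pCons power2_eq_square field_simps)
  qed
  then have "wt absolutely_integrable_on {-1..1}"
    by (rule nonnegative_absolutely_integrable_1) (simp add: wt_def)
  then show ?thesis
    unfolding set_integrable_def using wt_measurable by (subst (asm) integrable_completion) auto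
qed

lemma wt_cont_set_integrable:
  fixes g :: "real \<Rightarrow> 'b::euclidean_space"
  assumes "continuous_on {-1..1} g"
  shows "set_integrable lborel {-1..1} (\<lambda>x. wt x *\<^sub>R g x)"
proof -
  have "compact (g ` {-1..1})" using assms compact_continuous_image by blast
  then obtain B where B: "\<And>x. x \<in> {-1..1} \<Longrightarrow> norm (g x) \<le> B"
    by (metis bounded_iff compact_imp_bounded imageI)
  have "(\<lambda>x. indicator {-1..1} x *\<^sub>R g x) \<in> borel_measurable borel"
    by (intro borel_measurable_continuous_on_indicator assms) auto
  then have meas: "(\<lambda>x. wt x *\<^sub>R (indicator {-1..1} x *\<^sub>R g x)) \<in> borel_measurable lborel"
    unfolding measurable_lborel2 by (rule borel_measurable_scaleR[OF wt_measurable])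
  have int: "integrable lborel (\<lambda>x. B *\<^sub>R (indicator {-1..1} x *\<^sub>R wt x))"
    by (intro integrable_scaleR_right) (use wt_set_integrable in \<open>simp only: set_integrable_def\<close>)
  have "norm (wt x *\<^sub>R (indicator {-1..1} x *\<^sub>R g x)) \<le> norm (B *\<^sub>R (indicator {-1..1} x *\<^sub>R wt x))" for x
  proof (cases "x \<in> {-1..1}")
    case True
    then have "norm (g x) \<le> \<bar>B\<bar>" using B[of x] by linarith
    then have "\<bar>wt x\<bar> * norm (g x) \<le> \<bar>wt x\<bar> * \<bar>B\<bar>" by (rule mult_left_mono) simp
    then show ?thesis using True by (simp add: mult.commute[of "\<bar>B\<bar>"] abs_mult)
  qed simp
  then have "integrable lborel (\<lambda>x. wt x *\<^sub>R (indicator {-1..1} x *\<^sub>R g x))"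
    by (intro Bochner_Integration.integrable_bound[OF int meas] AE_I2)
  then show ?thesis unfolding set_integrable_def by (simp only: scaleR_left_commute)
qed

definition moment :: "complex poly \<Rightarrow> complex" where
  "moment f = (LINT x:{-1..1}|lborel. wt x *\<^sub>R poly f (of_real x))"

lemma moment_integrable: "set_integrable lborel {-1..1} (\<lambda>x. wt x *\<^sub>R poly f (complex_of_real x))"
  by (intro wt_cont_set_integrable continuous_on_poly_of_real)

lemma moment_add: "moment (f + g) = moment f + moment g"
  using set_integral_add(2)[OF moment_integrable moment_integrable, of f g]
  by (simp add: moment_def scaleR_add_right)

lemma moment_smult: "moment (smult c f) = c * moment f"
  unfolding moment_def by (subst set_integral_mult_right[symmetric]) (simp add: mult.commute)

lemma moment_pearson: "moment (pearson f) = 0"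
  unfolding moment_def set_borel_integral_eq_integral(2)[OF moment_integrable]
  by (rule integral_unique[OF pearson_has_integral])

lemma mform_nth: "mform (W p n) P Q $ i $ j = moment ((P ** Wpoly ** star Q) $ i $ j)"
proof -
  let ?R = "P ** Wpoly ** star Q"
  have eq: "mpoly_eval P x ** W p n x ** conj_transpose (mpoly_eval Q x) = wt x *\<^sub>R mpoly_eval ?R x" for x
    by (simp add: W_eq mpoly_eval_mult mpoly_eval_star matrix_mult_scaleR)
  have "continuous_on {-1..1} (\<lambda>x. mpoly_eval ?R x)"
    unfolding mpoly_eval_def map_matrix_def by (intro continuous_on_vec_lambda continuous_on_poly_of_real)
  then have "set_integrable lborel {-1..1} (\<lambda>x. wt x *\<^sub>R mpoly_eval ?R x)"
    by (rule wt_cont_set_integrable)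
  moreover have "bounded_linear (\<lambda>M::cmat. M $ i $ j)"
    by (intro bounded_linear_compose[OF bounded_linear_vec_nth bounded_linear_vec_nth])
  ultimately show ?thesis
    unfolding mform_def eq moment_def set_lebesgue_integral_def set_integrable_def
    by (subst integral_bounded_linear[symmetric]) (auto simp: mpoly_eval_def)
qed

lemma mform_add: "mform (W p n) (P + P') Q = mform (W p n) P Q + mform (W p n) P' Q"
  by (intro matrix2_eqI) (simp_all add: mform_nth matrix2_add_mult moment_add)

lemma mform_const_mult:
  "mform (W p n) (mpoly_const A ** P) Q = A ** mform (W p n) P Q"
  by (intro matrix2_eqI)
    (simp_all add: mform_nth matrix_mul_assoc[symmetric] matrix2_mult_nth[of "mpoly_const A"] matrix2_mult_nth[of A] moment_add moment_smult)

lemma mform_const_mult_right: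
  "mform (W p n) P (mpoly_const A ** Q) = mform (W p n) P Q ** conj_transpose A"
  by (intro matrix2_eqI)
    (simp_all add: mform_nth star_const_mult matrix_mul_assoc matrix2_mult_nth[of _ "mpoly_const A" for A]
      matrix2_mult_nth[of _ "conj_transpose A"] moment_add moment_smult mult.commute)


text \<open>The integrand is continuous and nonnegative, so a zero integral would make a nonzero
  polynomial vanish on an interval.\<close>

lemma moment_geg_square_nonzero: "moment ([:1, 0, -1:] * (geg w * geg w)) \<noteq> 0"
proof
  let ?g = "\<lambda>x. (1 - x\<^sup>2) powr (n / 2) * (poly (geg_real w) x)\<^sup>2"
  assume "moment ([:1, 0, -1:] * (geg w * geg w)) = 0"
  then have 0: "(LINT x:{-1..1}|lborel. wt x *\<^sub>R poly ([:1, 0, -1:] * (geg w * geg w)) (complex_of_real x)) = 0"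
    unfolding moment_def .
  note int = set_borel_integral_eq_integral[OF moment_integrable, of "[:1, 0, -1:] * (geg w * geg w)"]
  from integrable_integral[OF int(1)]
  have "((\<lambda>x. wt x *\<^sub>R poly ([:1, 0, -1:] * (geg w * geg w)) (complex_of_real x)) has_integral 0) {-1..1}"
    unfolding int(2)[symmetric] 0 .
  from has_integral_Re[OF this]
  have "(?g has_integral Re 0) {-1..1}"
  proof (rule has_integral_eq[rotated])
    fix x :: real assume x: "x \<in> {-1..1}"
    show "Re (wt x *\<^sub>R poly ([:1, 0, -1:] * (geg w * geg w)) (complex_of_real x)) = ?g x"
      unfolding wt_mult[OF x, symmetric]
      by (simp add: geg_def poly_map_poly_of_real power2_eq_square mult.assoc left_diff_distrib)
  qed
  then have int: "(?g has_integral 0) (cbox (-1) 1)" by simp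
  have cont: "continuous_on (cbox (-1) 1) ?g"
    using continuous_on_wt1 by (auto intro!: continuous_intros)
  have "poly (geg_real w) x = 0" if x: "x \<in> {-1<..<1}" for x
  proof -
    have "?g x = 0"
      by (rule has_integral_0_cbox_imp_0[OF cont _ int]) (use x in auto)
    then show ?thesis using one_minus_sq(2)[OF x] by simp
  qed
  then have "{-1<..<1} \<subseteq> {x. poly (geg_real w) x = 0}" by blast
  then have "infinite {x. poly (geg_real w) x = 0}"
    by (rule infinite_super) (simp add: infinite_Ioo)
  then have "geg_real w = 0" using poly_roots_finite by blast
  then show False using coeff_geg_top[of w] by (simp add: geg_def)
qed

text \<open>Integration by parts turns the form into its scalar analogue with weight $(1-x^2)^{n/2}$: \<^term>\<open>drop1\<close>
  and \<^term>\<open>drop2\<close> are, up to constants, adjoint to the rows of \<^term>\<open>lift\<close>.\<close>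

lemma lift_adjoint:
  "moment ((lift f g ** Wpoly ** transpose H) $ 1 $ j) = cp * moment ([:1, 0, -1:] * (f * drop1 H j))"
  "moment ((lift f g ** Wpoly ** transpose H) $ 2 $ j) = (cn - cp) * moment ([:1, 0, -1:] * (g * drop2 H j))"
proof -
  \<comment> \<open>The \<open>pearson\<close> term is the exact derivative produced by moving d/dx
    off \<open>f\<close>; it integrates to 0.\<close>
  have 1: "(lift f g ** Wpoly ** transpose H) $ 1 $ j = smult cp (pearson (f * (H $ j $ 2 - [:0, 1:] * H $ j $ 1))
      + [:1, 0, -1:] * (f * drop1 H j))"
    by (rule complex_poly_ext, simp add: matrix2_mult_nth transpose_def lift_nth Wpoly_def pearson_def drop1_def
      euler_def pderiv_mult pderiv_diff pderiv_pCons, algebra)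
  have 2: "(lift f g ** Wpoly ** transpose H) $ 2 $ j = smult (cn - cp) (pearson (g * (H $ j $ 1 - [:0, 1:] * H $ j $ 2))
      + [:1, 0, -1:] * (g * drop2 H j))"
    by (rule complex_poly_ext, simp add: matrix2_mult_nth transpose_def lift_nth Wpoly_def pearson_def drop2_def
      euler_def pderiv_mult pderiv_diff pderiv_pCons, algebra)
  show "moment ((lift f g ** Wpoly ** transpose H) $ 1 $ j) = cp * moment ([:1, 0, -1:] * (f * drop1 H j))"
    "moment ((lift f g ** Wpoly ** transpose H) $ 2 $ j) = (cn - cp) * moment ([:1, 0, -1:] * (g * drop2 H j))"
    unfolding 1 2 moment_smult moment_add moment_pearson by simp_all
qed

section \<open>Orthogonality and uniqueness of the monic sequence\<close>

lemma map_poly_cnj_geg: "map_poly cnj (geg w) = geg w"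
  by (rule poly_eqI) (simp add: geg_def coeff_map_poly)

lemma star_lift_geg: "star (lift_geg w) = transpose (lift_geg w)"
proof -
  have "map_poly cnj (pderiv f) = pderiv (map_poly cnj f)" for f
    by (rule poly_eqI) (simp add: coeff_map_poly coeff_pderiv)
  moreover have "map_poly cnj (euler c f) = euler (cnj c) (map_poly cnj f)" for c f
    by (rule poly_eqI) (simp add: coeff_map_poly)
  ultimately show ?thesis
    by (intro matrix2_eqI) (simp_all add: star_nth transpose_def lift_nth map_poly_cnj_geg)
qed

lemma mform_lift_geg:
  "mform (W p n) (lift_geg w) (lift_geg w') =
    mat2 (cp * (ea w' * (eb w' + 1)) * moment ([:1, 0, -1:] * (geg w * geg w'))) 0
      0 ((cn - cp) * ((ea w' + 1) * eb w') * moment ([:1, 0, -1:] * (geg w * geg w')))"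
proof -
  have m0: "moment 0 = 0" using moment_smult[of 0 0] by simp
  show ?thesis
    by (intro matrix2_eqI)
      (simp_all only: mform_nth star_lift_geg lift_adjoint drop_lift_geg mult_smult_right moment_smult mat2_nth
        mult_zero_right mult_zero_left m0 mult_ac)
qed

text \<open>The Gegenbauer operator is symmetric for the weight (1-x^2)^(n/2), by one integration by
  parts to a form symmetric in f' and g', and its eigenvalues are distinct.\<close>

lemma geg_orthogonal:
  assumes "w \<noteq> w'" shows "moment ([:1, 0, -1:] * (geg w * geg w')) = 0"
proof -
  let ?m = "\<lambda>f. moment ([:1, 0, -1:] * f)"
  have eq: "?m (f * gegenbauer_op g) = moment ([:1, 0, -1:] * ([:1, 0, -1:] * (pderiv f * pderiv g)))" for f g
  proof -
    have "[:1, 0, -1:] * (f * gegenbauer_op g) + pearson ([:1, 0, -1:] * (f * pderiv g)) =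
      [:1, 0, -1:] * ([:1, 0, -1:] * (pderiv f * pderiv g))"
      by (rule complex_poly_ext, simp add: pearson_def gegenbauer_op_def pderiv_mult pderiv_add pderiv_diff
          pderiv_minus pderiv_pCons, algebra)
    then show ?thesis by (metis moment_add moment_pearson add_0_right)
  qed
  have "?m (geg w * gegenbauer_op (geg w')) = ?m (geg w' * gegenbauer_op (geg w))"
    unfolding eq by (simp only: mult.commute)
  then have "et w' * ?m (geg w * geg w') = et w * ?m (geg w' * geg w)"
    by (simp only: geg_ode et_def mult_smult_right moment_smult)
  moreover have "et w \<noteq> et w'"
    using assms geg_eigenvalue_less[of w w'] geg_eigenvalue_less[of w' w] by (auto simp: et_def neq_iff)
  ultimately show ?thesis by (simp add: mult.commute[of "geg w'"])
qed

lemma mopQ_orthogonal: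
  assumes "w \<noteq> w'" shows "mform (W p n) (mopQ w) (mopQ w') = 0"
  unfolding mopQ_def mform_const_mult mform_const_mult_right mform_lift_geg geg_orthogonal[OF assms]
  by (intro matrix2_eqI) (simp_all add: matrix2_mult_nth)

lemma mopQ_nondegenerate:
  fixes A :: cmat
  assumes "A ** mform (W p n) (mopQ w) (mopQ w) = 0" shows "A = 0"
proof -
  define m where "m = moment ([:1, 0, -1:] * (geg w * geg w))"
  define x where "x = 1 / ea w * (cp * (ea w * (eb w + 1)) * m) * cnj (1 / ea w)"
  define y where "y = 1 / eb w * ((cn - cp) * ((ea w + 1) * eb w) * m) * cnj (1 / eb w)"
  have "mform (W p n) (mopQ w) (mopQ w) = mat2 x 0 0 y"
    unfolding mopQ_def mform_const_mult mform_const_mult_right mform_lift_geg m_def[symmetric] x_def y_def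
    by (intro matrix2_eqI) (simp_all add: matrix2_mult_nth conj_transpose_def transpose_def)
  moreover have "x \<noteq> 0" "y \<noteq> 0"
    using p_pos np_pos ea_nonzero[of w] eb_nonzero[of w] moment_geg_square_nonzero[of w, folded m_def]
    by (auto simp: x_def y_def)
  ultimately have A: "A ** mat2 x 0 0 y = 0" "x \<noteq> 0" "y \<noteq> 0" using assms by simp_all
  have "(A ** mat2 x 0 0 y) $ i $ j = 0" for i j unfolding A by simp
  from this[of _ 1] this[of _ 2] A(2,3) show ?thesis
    by (simp add: matrix2_mult_nth vec_eq_iff forall_2)
qed

text \<open>Subtracting the leading term preserves orthogonality to the lower \<open>mopQ k\<close>,
  so the rest is zero by induction; pairing with the last \<open>mopQ\<close> then removes the
  leading coefficient.\<close>

lemma mform_zero_imp_zero: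
  assumes "deg_below w P" "\<And>k. k < w \<Longrightarrow> mform (W p n) P (mopQ k) = 0"
  shows "P = 0"
  using assms
proof (induction w arbitrary: P)
  case 0 then show ?case by (simp add: deg_below_0)
next
  case (Suc w)
  define A where "A = mcoeff w P"
  define P' where "P' = P - mpoly_const A ** mopQ w"
  have P: "P = P' + mpoly_const A ** mopQ w" by (simp add: P'_def)
  have eq: "mform (W p n) P (mopQ k) = mform (W p n) P' (mopQ k) + A ** mform (W p n) (mopQ w) (mopQ k)" for k
    unfolding P mform_add mform_const_mult ..
  have "mform (W p n) P' (mopQ k) = 0" if "k < w" for k
    using that Suc.prems(2)[of k] eq[of k] mopQ_orthogonal[of w k] by simp
  then have "P' = 0"
    using Suc.IH monic_reduce[OF mopQ_monic Suc.prems(1)] unfolding P'_def A_def by blast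
  moreover have "mform (W p n) 0 (mopQ w) = 0"
    using mform_add[of 0 0 "mopQ w"] by simp
  ultimately have "A ** mform (W p n) (mopQ w) (mopQ w) = 0"
    using Suc.prems(2)[of w] eq[of w] by simp
  then have "A = 0" by (rule mopQ_nondegenerate)
  then show ?case using P \<open>P' = 0\<close> by (simp add: vec_eq_iff matrix2_mult_nth)
qed

text \<open>\<open>mop\<close> is a definite description, so uniqueness is needed as well: a rival
  \<open>R w\<close> differs from \<open>mopQ w\<close> in degree below w and is orthogonal to all
  earlier terms, which agree by induction.\<close>

lemma mop_eq: "mop (W p n) = mopQ"
  unfolding mop_def
proof (rule the_equality)
  show "monic_orthogonal (W p n) mopQ"
    by (simp add: monic_orthogonal_def mopQ_monic mopQ_orthogonal)
  fix R assume R: "monic_orthogonal (W p n) R"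
  have "R w = mopQ w" for w
  proof (induction w rule: less_induct)
    case (less w)
    have "deg_below w (R w - mopQ w)"
      using monic_reduce[OF mopQ_monic[of w], of "R w"] R by (simp add: monic_orthogonal_def mpoly_monic_iff)
    moreover have "mform (W p n) (R w - mopQ w) (mopQ k) = 0" if "k < w" for k
    proof -
      have "mform (W p n) (R w) (mopQ k) = 0"
        using R that less.IH[OF that] by (metis monic_orthogonal_def less_irrefl)
      then show ?thesis
        using mform_add[of "R w - mopQ w" "mopQ w" "mopQ k"] mopQ_orthogonal[of w k] that by simp
    qed
    ultimately have "R w - mopQ w = 0" by (rule mform_zero_imp_zero)
    then show ?case by simp
  qed
  then show "R = mopQ" by (rule ext)
qed

lemma diff_algebra_eq: "diff_algebra (W p n) = {D. \<exists>L. has_eigen D L}"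
  unfolding diff_algebra_def mop_eq has_eigen_def diffops_def by (auto intro: choice)

end

theorem theorem5p1:
  fixes n p :: real
  assumes "0 < p" and "p < n / 2"
  shows "{D1 p n, D2 p n, D3 p n, D4 p n} \<subseteq> diff_algebra (W p n)
    \<and> diff_algebra (W p n) = generated_algebra {D1 p n + D2 p n, D3 p n + D4 p n}"
proof -
  interpret gegenbauer_weight n p by unfold_locales (rule assms)+
  show ?thesis
    unfolding diff_algebra_eq
    using has_eigen_D1 has_eigen_D2 has_eigen_D3 has_eigen_D4 has_eigen_generated generated_has_eigen
    by blast
qed

end
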